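(* Suppose $m\ge 1$ and $t\ge 2m+2$ are integers, and $d_{\mathrm{plan}}$ is a uniform balanced repeated measurements design (UBRMD) with $t$ treatments, $t$ time periods and $s=gt$ subjects. Let $d_{\min}$ be the design consisting of the first $t-m$ periods of $d_{\mathrm{plan}}$, and denote the eigenvalues of its direct-effects information matrix $C_D^{d_{\min}}$ by $g\theta_0=0,\ g\theta_1,\dots,g\theta_{t-1}$ (listed with multiplicity, with $g\theta_0=0$ belonging to the eigenvector $\mathbf 1_t$). Then for $r=1,\dots,t-1$, $\theta_r\ge\theta_L(t,m)$, where $$\theta_L(t,m)=\frac{t}{t-m}\left[(t-2m)-\frac{t(m+1)^2}{(t-m)^2-(t+1)-m(m+1)}\right].$$
   Context: A (crossover) design with $p$ periods, $s$ subjects and $t$ treatments labelled $0,\dots,t-1$ assigns a treatment $d(k,i)$ to each subject $i\in\{1,\dots,s\}$ in each period $k\in\{1,\dots,p\}$. It is uniform if each subject receives every treatment in the same number of periods and in each period every treatment is given to the same number of subjects. It is balanced if, in the order of application, each treatment is immediately preceded by every other treatment the same number of times and is never immediately preceded by itself. A UBRMD with $t$ treatments, $t$ periods and $s=gt$ subjects ($g$ a positive integer) is a uniform and balanced such design (so each subject receives each treatment exactly once, and each treatment appears $g$ times in each period). Model: $Y=X_S\beta+X_P\alpha+X_D\tau+X_C\rho+\epsilon$, with fixed subject, period, direct treatment and carry-over effects. With rows indexed by (subject $i$, period $k$): $X_S=I_s\otimes\mathbf 1_p$, $X_P=\mathbf 1_s\otimes I_p$; the row of $X_D$ for $(i,k)$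 has a $1$ in the column of treatment $d(k,i)$ and $0$ elsewhere; the row of $X_C$ for $(i,k)$ has a $1$ in the column of treatment $d(k-1,i)$ and $0$ elsewhere if $k\ge2$, and is zero if $k=1$. Put $N_{ab}=X_a'X_b$ for $a,b\in\{S,P,D,C\}$, $r_D=N_{DS}\mathbf 1_s$, $r_C=N_{CS}\mathbf 1_s$, $r_D^\delta=\mathrm{diag}(r_D)$, $r_C^\delta=\mathrm{diag}(r_C)$, and $C_{11}=r_D^\delta+\frac1{ps}r_Dr_D'-\frac1pN_{DS}N_{SD}-\frac1sN_{DP}N_{PD}$, $C_{22}=r_C^\delta+\frac1{ps}r_Cr_C'-\frac1pN_{CS}N_{SC}-\frac1sN_{CP}N_{PC}$, $C_{12}=N_{DC}+\frac1{ps}r_Dr_C'-\frac1pN_{DS}N_{SC}-\frac1sN_{DP}N_{PC}$, $C_{21}=C_{12}'$. The direct-effects information matrix of the design $d$ is the $t\times t$ matrix $C_D^d=C_{11}-C_{12}C_{22}^{-}C_{21}$, where $M^-$ is any generalized inverse ($MM^-M=M$). For $d_{\min}$ these are computed with $p=t-m$, $s=gt$. Here $'$ is transpose and $\mathbf 1_a$ is the all-ones vector of length $a$. *)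

theory Defs
  imports "Jordan_Normal_Form.Char_Poly"
begin

(* A design is the matrix d with d $$ (k,i) the treatment given to subject i in period k.
   Periods, subjects and treatments are all numbered from 0, so dim_row d is the number p of
   periods and dim_col d is the number s of subjects. *)
type_synonym design = "nat mat"

definition is_design :: "nat \<Rightarrow> nat \<Rightarrow> nat \<Rightarrow> design \<Rightarrow> bool" where
  "is_design p s t d \<longleftrightarrow> d \<in> carrier_mat p s \<and> (\<forall>k<p. \<forall>i<s. d $$ (k,i) < t)"

definition uniform :: "nat \<Rightarrow> design \<Rightarrow> bool" where
  "uniform t d \<longleftrightarrow>
     (\<forall>i<dim_col d. \<forall>a<t. \<forall>b<t.
        card {k. k < dim_row d \<and> d $$ (k,i) = a} = card {k. k < dim_row d \<and> d $$ (k,i) = b}) \<and>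
     (\<forall>k<dim_row d. \<forall>a<t. \<forall>b<t.
        card {i. i < dim_col d \<and> d $$ (k,i) = a} = card {i. i < dim_col d \<and> d $$ (k,i) = b})"

definition precede_count :: "design \<Rightarrow> nat \<Rightarrow> nat \<Rightarrow> nat" where
  "precede_count d a b =
     card {(k,i). Suc k < dim_row d \<and> i < dim_col d \<and> d $$ (k,i) = a \<and> d $$ (Suc k,i) = b}"

definition balanced :: "nat \<Rightarrow> design \<Rightarrow> bool" where
  "balanced t d \<longleftrightarrow>
     (\<exists>l. \<forall>a<t. \<forall>b<t. precede_count d a b = (if a = b then 0 else l))"

definition UBRMD :: "nat \<Rightarrow> nat \<Rightarrow> design \<Rightarrow> bool" where
  "UBRMD t g d \<longleftrightarrow> 0 < g \<and> is_design t (g * t) t d \<and> uniform t d \<and> balanced t d"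

definition first_periods :: "nat \<Rightarrow> design \<Rightarrow> design" where
  "first_periods q d = Matrix.mat q (dim_col d) (\<lambda>(k,i). d $$ (k,i))"

definition kron :: "real mat \<Rightarrow> real mat \<Rightarrow> real mat" where
  "kron A B = Matrix.mat (dim_row A * dim_row B) (dim_col A * dim_col B)
     (\<lambda>(i,j). A $$ (i div dim_row B, j div dim_col B) * B $$ (i mod dim_row B, j mod dim_col B))"

definition ones_vec :: "nat \<Rightarrow> real vec" where
  "ones_vec n = Matrix.vec n (\<lambda>_. 1)"

definition ones_col :: "nat \<Rightarrow> real mat" where
  "ones_col n = Matrix.mat n 1 (\<lambda>_. 1)"

(* The row for subject i and period k of each model matrix has index l = i * p + k,
   so that i = l div p and k = l mod p; this is the ordering implicit in the Kronecker products. *)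

definition X_S :: "design \<Rightarrow> real mat" where
  "X_S d = kron (1\<^sub>m (dim_col d)) (ones_col (dim_row d))"

definition X_P :: "design \<Rightarrow> real mat" where
  "X_P d = kron (ones_col (dim_col d)) (1\<^sub>m (dim_row d))"

definition X_D :: "nat \<Rightarrow> design \<Rightarrow> real mat" where
  "X_D t d = Matrix.mat (dim_col d * dim_row d) t
     (\<lambda>(l,a). let i = l div dim_row d; k = l mod dim_row d in
        if d $$ (k,i) = a then 1 else 0)"

definition X_C :: "nat \<Rightarrow> design \<Rightarrow> real mat" where
  "X_C t d = Matrix.mat (dim_col d * dim_row d) t
     (\<lambda>(l,a). let i = l div dim_row d; k = l mod dim_row d in
        if 1 \<le> k \<and> d $$ (k - 1,i) = a then 1 else 0)"

definition N :: "real mat \<Rightarrow> real mat \<Rightarrow> real mat" where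
  "N A B = transpose_mat A * B"

(* The vectors r_D and r_C are represented as t x 1 matrices. *)

definition r_D :: "nat \<Rightarrow> design \<Rightarrow> real mat" where
  "r_D t d = N (X_D t d) (X_S d) * ones_col (dim_col d)"

definition r_C :: "nat \<Rightarrow> design \<Rightarrow> real mat" where
  "r_C t d = N (X_C t d) (X_S d) * ones_col (dim_col d)"

definition C11 :: "nat \<Rightarrow> design \<Rightarrow> real mat" where
  "C11 t d = (let p = real (dim_row d); s = real (dim_col d) in
     mat_diag t (\<lambda>a. r_D t d $$ (a,0))
     + (1 / (p * s)) \<cdot>\<^sub>m (r_D t d * transpose_mat (r_D t d))
     - (1 / p) \<cdot>\<^sub>m (N (X_D t d) (X_S d) * N (X_S d) (X_D t d))
     - (1 / s) \<cdot>\<^sub>m (N (X_D t d) (X_P d) * N (X_P d) (X_D t d)))"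

definition C22 :: "nat \<Rightarrow> design \<Rightarrow> real mat" where
  "C22 t d = (let p = real (dim_row d); s = real (dim_col d) in
     mat_diag t (\<lambda>a. r_C t d $$ (a,0))
     + (1 / (p * s)) \<cdot>\<^sub>m (r_C t d * transpose_mat (r_C t d))
     - (1 / p) \<cdot>\<^sub>m (N (X_C t d) (X_S d) * N (X_S d) (X_C t d))
     - (1 / s) \<cdot>\<^sub>m (N (X_C t d) (X_P d) * N (X_P d) (X_C t d)))"

definition C12 :: "nat \<Rightarrow> design \<Rightarrow> real mat" where
  "C12 t d = (let p = real (dim_row d); s = real (dim_col d) in
     N (X_D t d) (X_C t d)
     + (1 / (p * s)) \<cdot>\<^sub>m (r_D t d * transpose_mat (r_C t d))
     - (1 / p) \<cdot>\<^sub>m (N (X_D t d) (X_S d) * N (X_S d) (X_C t d))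
     - (1 / s) \<cdot>\<^sub>m (N (X_D t d) (X_P d) * N (X_P d) (X_C t d)))"

definition C21 :: "nat \<Rightarrow> design \<Rightarrow> real mat" where
  "C21 t d = transpose_mat (C12 t d)"

definition gen_inverse :: "real mat \<Rightarrow> real mat \<Rightarrow> bool" where
  "gen_inverse M G \<longleftrightarrow> G \<in> carrier_mat (dim_col M) (dim_row M) \<and> M * G * M = M"

(* G stands for the generalized inverse of C22 t d that is used. *)
definition C_D :: "nat \<Rightarrow> design \<Rightarrow> real mat \<Rightarrow> real mat" where
  "C_D t d G = C11 t d - C12 t d * G * C21 t d"

(* g * \<theta> 0, ..., g * \<theta> (n - 1) is the list of all eigenvalues of the n x n matrix A, repeated
   according to multiplicity, in no particular order except that \<theta> 0 = 0 comes first. *)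
definition scaled_eigenvalues :: "real mat \<Rightarrow> nat \<Rightarrow> (nat \<Rightarrow> real) \<Rightarrow> bool" where
  "scaled_eigenvalues A g \<theta> \<longleftrightarrow>
     \<theta> 0 = 0 \<and> char_poly A = (\<Prod>r<dim_row A. [:- (real g * \<theta> r), 1:])"

definition theta_L :: "nat \<Rightarrow> nat \<Rightarrow> real" where
  "theta_L t m = (let t' = real t; m' = real m in
     t' / (t' - m') *
       ((t' - 2 * m') -
        t' * (m' + 1)^2 / ((t' - m')^2 - (t' + 1) - m' * (m' + 1))))"

end

theory Submission
  imports Defs "HOL-Analysis.Convex"
begin

text \<open>Write $p = t - m$. For all designs, \<open>C11\<close>, \<open>C12\<close> and \<open>C22\<close> are the blocks of the Gram matrix of the direct and
  carry-over effects after both have been projected orthogonally to the subject and period effects.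
  In particular they annihilate the all-ones vector, so only sum-zero vectors $x$, $y$ matter; for these the
  period effects drop out.

  In the full plan every subject sees every treatment once, so the sum of the values of $x$ over the $p$
  periods kept for a subject is minus the sum over the $m$ periods dropped. Cauchy-Schwarz
  and the fact that each treatment occurs $g$ times in each period then give
  $x' C_{11} x \geq \alpha |x|^2$ with $\alpha = g (p - m^2/p)$ and $y' C_{22} y \geq c |y|^2$ with
  $c = g (p - 1 - (m+1)^2/p)$. Balance turns the number of successions of treatments in the full plan into
  $g (J - I)$, up to the $m$ successions per subject that are dropped, whence
  $|x' C_{12} y| \leq b |x| |y|$ with $b = g (m+1) t/p$. The Schur complement is
  therefore at least $\alpha - b^2/c = g \theta_L(t,m)$ on sum-zero vectors.\<close>

section \<open>Real symmetric matrices\<close>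

text \<open>Over the complex numbers a root \<open>c\<close> has an eigenvector v. Moving the
  symmetric matrix from v to its conjugate gives c |v|^2 = cnj c |v|^2, so \<open>c\<close> is real.
  The splitting later shows that a list of eigenvalues exists at all.\<close>

lemma real_symmetric_char_poly_splits:
  fixes A :: "real mat"
  assumes A: "A \<in> carrier_mat n n" and sym: "transpose_mat A = A"
  obtains as where "char_poly A = (\<Prod>a\<leftarrow>as. [:- a, 1:])" "length as = n"
proof -
  define B where "B = map_mat complex_of_real A"
  have B: "B \<in> carrier_mat n n" using A by (simp add: B_def)
  have BT: "transpose_mat B = B"
    using sym by (metis B_def map_mat_transpose)
  obtain cs where cs: "char_poly B = (\<Prod>a\<leftarrow>cs. [:- a, 1:])" and len: "length cs = n"
    using char_poly_factorized[OF B] by blast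
  have real: "complex_of_real (Re c) = c" if "c \<in> set cs" for c
  proof -
    have "poly (char_poly B) c = 0"
      unfolding cs poly_prod_list using that by (auto simp: prod_list_zero_iff image_iff)
    then obtain v where "eigenvector B v c"
      using eigenvalue_root_char_poly[OF B] by (auto simp: eigenvalue_def)
    then have v: "v \<in> carrier_vec n" and v0: "v \<noteq> 0\<^sub>v n" and Bv: "B *\<^sub>v v = c \<cdot>\<^sub>v v"
      using B by (auto simp: eigenvector_def)
    have Bcv: "B *\<^sub>v conjugate v = conjugate (B *\<^sub>v v)"
    proof (rule eq_vecI)
      fix i assume "i < dim_vec (conjugate (B *\<^sub>v v))"
      then have i: "i < n" using B by simp
      then show "(B *\<^sub>v conjugate v) $ i = conjugate (B *\<^sub>v v) $ i"
        using v A by (simp add: B_def scalar_prod_def)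
    qed (use B in simp)
    have "c * (v \<bullet>c v) = (transpose_mat B *\<^sub>v v) \<bullet>c v"
      using v by (simp add: BT Bv)
    also have "\<dots> = v \<bullet> (B *\<^sub>v conjugate v)"
      using v B by (intro transpose_vec_mult_scalar) auto
    also have "\<dots> = cnj c * (v \<bullet>c v)"
      using v by (simp add: Bcv Bv conjugate_smult_vec)
    finally have "c = cnj c"
      using v v0 by simp
    then show ?thesis
      by (simp add: complex_eq_iff)
  qed
  define as where "as = map Re cs"
  have cs_as: "cs = map complex_of_real as"
    unfolding as_def using real by (simp add: map_idI)
  interpret hom: map_poly_comm_ring_hom complex_of_real ..
  have "map_poly complex_of_real (char_poly A) = char_poly B"
    unfolding B_def by (rule of_real_hom.char_poly_hom[OF A, symmetric])
  also have "\<dots> = map_poly complex_of_real (\<Prod>a\<leftarrow>as. [:- a, 1:])"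
    unfolding cs cs_as by (induction as) (simp_all add: hom.hom_mult del: mult_pCons_left)
  finally have "char_poly A = (\<Prod>a\<leftarrow>as. [:- a, 1:])"
    by (simp add: poly_eq_iff)
  then show ?thesis
    using that[of as] len by (simp add: as_def)
qed

text \<open>In a basis of the all-ones vector and sum-zero vectors, \<open>C\<close> becomes block
  diagonal with a zero block of size one. Splitting off exactly one factor X leaves the roots of
  \<open>C'\<close>, each with a sum-zero eigenvector, even if 0 is a multiple eigenvalue of
  \<open>C\<close>.\<close>

lemma zero_sums_deflation:
  fixes C :: "real mat"
  assumes C: "C \<in> carrier_mat (Suc k) (Suc k)"
    and rows: "\<And>i. i < Suc k \<Longrightarrow> (\<Sum>j<Suc k. C $$ (i,j)) = 0"
    and cols: "\<And>j. j < Suc k \<Longrightarrow> (\<Sum>i<Suc k. C $$ (i,j)) = 0"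
  obtains C' where "C' \<in> carrier_mat k k" "char_poly C = [:0, 1:] * char_poly C'"
    "\<And>l. eigenvalue C' l \<Longrightarrow>
       \<exists>x\<in>carrier_vec (Suc k). x \<noteq> 0\<^sub>v (Suc k) \<and> (\<Sum>a<Suc k. x $ a) = 0 \<and> C *\<^sub>v x = l \<cdot>\<^sub>v x"
proof -
  define n where "n = Suc k"
  have n: "real n \<noteq> 0" by (simp add: n_def)
  \<comment> \<open>Change of basis to the all-ones vector and the differences of unit vectors, which are orthogonal to it.\<close>
  define P :: "real mat" where
    "P = Matrix.mat n n (\<lambda>(i,j). if j = 0 \<or> i = j then 1 else if i = 0 then - 1 else 0)"
  \<comment> \<open>The inverse change of basis: row 0 takes the mean of a vector, every other row
    the deviation of one coordinate from the mean.\<close>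
  define Q :: "real mat" where
    "Q = Matrix.mat n n (\<lambda>(i,j). if i = 0 then 1 / n else (if i = j then 1 else 0) - 1 / n)"
  have carr [simp]: "C \<in> carrier_mat n n" "P \<in> carrier_mat n n" "Q \<in> carrier_mat n n"
    using C by (simp_all add: n_def P_def Q_def)
  note [simp] = carr[THEN carrier_matD(1)] carr[THEN carrier_matD(2)]
  have P_sum: "(\<Sum>i<n. P $$ (i,j)) = (if j = 0 then n else 0)" if "j < n" for j
  proof -
    have "(\<Sum>i<n. P $$ (i,j)) = P $$ (0,j) + (\<Sum>i<k. P $$ (Suc i, j))"
      unfolding n_def by (rule sum.lessThan_Suc_shift)
    also have "(\<Sum>i<k. P $$ (Suc i, j)) = (\<Sum>i<k. if j = 0 \<or> Suc i = j then 1 else 0)"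
      using that by (intro sum.cong) (auto simp: P_def n_def)
    finally show ?thesis
      using that by (cases j) (auto simp: P_def n_def)
  qed
  have QP: "Q * P = 1\<^sub>m n"
  proof (rule eq_matI)
    fix i j assume "i < dim_row (1\<^sub>m n :: real mat)" "j < dim_col (1\<^sub>m n :: real mat)"
    then have ij: "i < n" "j < n" by auto
    have "(Q * P) $$ (i,j) = (\<Sum>l<n. Q $$ (i,l) * P $$ (l,j))"
      using ij by (simp add: scalar_prod_def P_def Q_def lessThan_atLeast0)
    also have "\<dots> = (\<Sum>l<n. (if i = 0 then 0 else if l = i then P $$ (l,j) else 0) + (if i = 0 then 1/n else -1/n) * P $$ (l,j))"
      using ij by (intro sum.cong) (auto simp: Q_def algebra_simps)
    also have "\<dots> = (if i = 0 then 0 else P $$ (i,j)) + (if i = 0 then 1/n else -1/n) * (\<Sum>l<n. P $$ (l,j))"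
      using ij by (simp add: sum.distrib sum_distrib_left[symmetric])
    also have "\<dots> = 1\<^sub>m n $$ (i,j)"
      using ij n unfolding P_sum[OF ij(2)] by (auto simp: P_def)
    finally show "(Q * P) $$ (i,j) = 1\<^sub>m n $$ (i,j)" .
  qed (auto simp: P_def Q_def)
  then have PQ: "P * Q = 1\<^sub>m n"
    by (rule mat_mult_left_right_inverse[rotated 2]) simp_all
  define B where "B = Q * C * P"
  have carr_B [simp]: "B \<in> carrier_mat n n"
    unfolding B_def by (intro mult_carrier_mat[of _ n n]) simp_all
  note [simp] = carr_B[THEN carrier_matD(1)] carr_B[THEN carrier_matD(2)]
  have "C = P * B * Q"
  proof -
    have "P * B = P * (Q * (C * P))"
      unfolding B_def by (subst assoc_mult_mat[of Q n n C n P n]) simp_all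
    also have "\<dots> = (P * Q) * (C * P)"
      using assoc_mult_mat[of P n n Q n "C * P" n] mult_carrier_mat[of C n n P n] by simp
    also have "\<dots> = C * P"
      unfolding PQ by (rule left_mult_one_mat) (rule mult_carrier_mat[of C n n]; rule carr)
    finally have "P * B * Q = C * (P * Q)"
      using assoc_mult_mat[of C n n P n Q n] by simp
    then show ?thesis unfolding PQ using right_mult_one_mat[of C n n] by simp
  qed
  then have "similar_mat C B"
    using PQ QP carr carr_B by (intro similar_matI[of _ _ P Q n]) blast+
  then have cp: "char_poly C = char_poly B"
    by (rule char_poly_similar)
  \<comment> \<open>Column 0 of \<open>P\<close> is all ones and row 0 of \<open>Q\<close> is
    constant. So zero row sums kill the first column of \<open>B\<close>, and zero column sums its
    first row.\<close>
  have CP: "(C * P) $$ (i,0) = 0" if "i < n" for i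
    using rows[of i] that C by (simp add: scalar_prod_def P_def n_def lessThan_atLeast0)
  have QC: "(Q * C) $$ (0,j) = 0" if "j < n" for j
    using cols[of j] that C
    by (simp add: scalar_prod_def Q_def n_def lessThan_atLeast0 sum_divide_distrib[symmetric])
  have B_col: "B $$ (i,0) = 0" if "i < n" for i
  proof -
    have "B = Q * (C * P)" unfolding B_def by (rule assoc_mult_mat[of Q n n C n P n]) simp_all
    then have "B $$ (i,0) = row Q i \<bullet> col (C * P) 0"
      using that by (simp add: n_def Q_def P_def)
    also have "col (C * P) 0 = 0\<^sub>v n"
      using CP C by (intro eq_vecI) (auto simp: n_def P_def)
    finally show ?thesis using that by (simp add: Q_def)
  qed
  have B_row: "B $$ (0,j) = 0" if "j < n" for j
  proof -
    have "B $$ (0,j) = row (Q * C) 0 \<bullet> col P j"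
      using that unfolding B_def by (simp add: n_def Q_def P_def)
    also have "row (Q * C) 0 = 0\<^sub>v n"
      using QC C by (intro eq_vecI) (auto simp: n_def Q_def)
    finally show ?thesis using that by (simp add: P_def)
  qed
  define C' where "C' = Matrix.mat k k (\<lambda>(i,j). B $$ (Suc i, Suc j))"
  have C': "C' \<in> carrier_mat k k" by (simp add: C'_def)
  have "B = four_block_mat (0\<^sub>m 1 1) (0\<^sub>m 1 k) (0\<^sub>m k 1) C'"
  proof (rule eq_matI)
    fix i j assume "i < dim_row (four_block_mat (0\<^sub>m 1 1) (0\<^sub>m 1 k) (0\<^sub>m k 1) C')"
      "j < dim_col (four_block_mat (0\<^sub>m 1 1) (0\<^sub>m 1 k) (0\<^sub>m k 1) C')"
    then have "i < n" "j < n" by (auto simp: n_def C'_def)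
    then show "B $$ (i,j) = four_block_mat (0\<^sub>m 1 1) (0\<^sub>m 1 k) (0\<^sub>m k 1) C' $$ (i,j)"
      using B_row[of j] B_col[of i] by (cases i; cases j) (auto simp: C'_def n_def)
  qed (use \<open>B \<in> carrier_mat n n\<close> in \<open>auto simp: n_def C'_def\<close>)
  then have "char_poly B = char_poly (0\<^sub>m 1 1) * char_poly C'"
    using char_poly_four_block_zeros_col[of "0\<^sub>m 1 1" "0\<^sub>m 1 k" k C'] C' by simp
  also have "char_poly (0\<^sub>m 1 1 :: real mat) = [:0, 1:]"
    by (simp add: char_poly_defs det_single)
  finally have char: "char_poly C = [:0, 1:] * char_poly C'"
    using cp by simp
  show ?thesis
  proof (rule that[OF C' char])
    fix l assume "eigenvalue C' l"
    then obtain w where w: "w \<in> carrier_vec k" "w \<noteq> 0\<^sub>v k" and ev: "C' *\<^sub>v w = l \<cdot>\<^sub>v w"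
      using C' by (auto simp: eigenvalue_def eigenvector_def)
    \<comment> \<open>Coordinate 0 in the new basis is the mean, so prefixing 0 to \<open>w\<close>
      makes \<open>x\<close> sum-zero.\<close>
    define v where "v = vCons 0 w"
    define x where "x = P *\<^sub>v v"
    have v: "v \<in> carrier_vec n" using w by (simp add: v_def n_def)
    have x: "x \<in> carrier_vec n" unfolding x_def by (rule mult_mat_vec_carrier[OF carr(2) v])
    have Qx: "Q *\<^sub>v x = v"
      unfolding x_def using v by (simp add: assoc_mult_mat_vec[symmetric, of _ n n _ n] QP)
    have Bv: "B *\<^sub>v v = l \<cdot>\<^sub>v v"
    proof (rule eq_vecI)
      fix i assume "i < dim_vec (l \<cdot>\<^sub>v v)"
      then have i: "i < n" using v by simp
      have *: "(B *\<^sub>v v) $ i = (\<Sum>j<k. B $$ (i, Suc j) * w $ j)"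
        using i v w
        by (simp add: n_def v_def scalar_prod_def sum.atLeast0_lessThan_Suc_shift lessThan_atLeast0 del: sum.op_ivl_Suc)
      show "(B *\<^sub>v v) $ i = (l \<cdot>\<^sub>v v) $ i"
      proof (cases i)
        case 0
        then show ?thesis using * B_row w by (simp add: v_def n_def)
      next
        case (Suc i')
        then have i': "i' < k" using i by (simp add: n_def)
        have "(C' *\<^sub>v w) $ i' = (\<Sum>j<k. B $$ (Suc i', Suc j) * w $ j)"
          using i' w by (simp add: C'_def scalar_prod_def lessThan_atLeast0)
        then show ?thesis using * ev Suc i' w by (simp add: v_def)
      qed
    qed (use v \<open>B \<in> carrier_mat n n\<close> in auto)
    have "C *\<^sub>v x = P *\<^sub>v (B *\<^sub>v (Q *\<^sub>v x))"
      using x by (subst \<open>C = P * B * Q\<close>)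
        (simp add: assoc_mult_mat_vec[of _ n n _ n] assoc_mult_mat_vec[of P n n B n "Q *\<^sub>v x"]
          mult_carrier_mat[of _ n n] mult_mat_vec_carrier[of Q n n])
    also have "\<dots> = l \<cdot>\<^sub>v x"
      unfolding Qx Bv using mult_mat_vec[of P n n v l] v by (simp add: x_def)
    finally have Cx: "C *\<^sub>v x = l \<cdot>\<^sub>v x" .
    have "x \<noteq> 0\<^sub>v n"
    proof
      assume "x = 0\<^sub>v n"
      then have "v = 0\<^sub>v n" using Qx by (auto simp: Q_def)
      then have "w $ i = 0" if "i < k" for i
        using that by (metis v_def vec_index_vCons_Suc index_zero_vec(1) n_def Suc_mono)
      then show False using w by (metis eq_vecI index_zero_vec carrier_vecD)
    qed
    moreover have "(\<Sum>a<n. x $ a) = 0"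
    proof -
      have "(Q *\<^sub>v x) $ 0 = (\<Sum>a<n. x $ a) / n"
        using x by (simp add: Q_def n_def scalar_prod_def lessThan_atLeast0 sum_divide_distrib del: sum.op_ivl_Suc)
      then show ?thesis using Qx n by (simp add: v_def)
    qed
    ultimately show "\<exists>x\<in>carrier_vec (Suc k). x \<noteq> 0\<^sub>v (Suc k) \<and> (\<Sum>a<Suc k. x $ a) = 0 \<and> C *\<^sub>v x = l \<cdot>\<^sub>v x"
      using x Cx by (auto simp: n_def)
  qed
qed

section \<open>The information matrices as adjusted inner products\<close>

lemma sum_grid:
  fixes f :: "nat \<Rightarrow> 'a::comm_monoid_add"
  shows "(\<Sum>l<s * p. f l) = (\<Sum>i<s. \<Sum>k<p. f (i * p + k))"
proof -
  have "(\<Sum>l<s * p. f l) = (\<Sum>i<s. \<Sum>l\<in>{i * p..<i * p + p}. f l)"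
    by (rule sum.nat_group[symmetric])
  also have "\<dots> = (\<Sum>i<s. \<Sum>k<p. f (i * p + k))"
  proof (rule sum.cong[OF refl])
    fix i
    show "(\<Sum>l\<in>{i * p..<i * p + p}. f l) = (\<Sum>k<p. f (i * p + k))"
      using sum.shift_bounds_nat_ivl[of f 0 "i * p" p] by (simp add: lessThan_atLeast0 add.commute)
  qed
  finally show ?thesis .
qed

lemma grid_less: "i < s \<Longrightarrow> k < p \<Longrightarrow> i * p + k < s * (p::nat)"
proof -
  assume "i < s" "k < p"
  then have "i * p + k < Suc i * p" by simp
  also have "\<dots> \<le> s * p" using \<open>i < s\<close> by (intro mult_le_mono1) simp
  finally show ?thesis .
qed

text \<open>For positive \<open>p\<close> and \<open>s\<close> this is the inner product of
  \<open>f\<close> and \<open>h\<close> after double centering, that is, after projecting both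
  orthogonally to all subject and period effects.\<close>

definition adjusted_form :: "nat \<Rightarrow> nat \<Rightarrow> (nat \<Rightarrow> nat \<Rightarrow> real) \<Rightarrow> (nat \<Rightarrow> nat \<Rightarrow> real) \<Rightarrow> real" where
  "adjusted_form p s f h =
     (\<Sum>i<s. \<Sum>k<p. f k i * h k i)
     + 1 / (real p * real s) * ((\<Sum>i<s. \<Sum>k<p. f k i) * (\<Sum>i<s. \<Sum>k<p. h k i))
     - 1 / real p * (\<Sum>i<s. (\<Sum>k<p. f k i) * (\<Sum>k<p. h k i))
     - 1 / real s * (\<Sum>k<p. (\<Sum>i<s. f k i) * (\<Sum>i<s. h k i))"

section \<open>Model matrices: dimensions, and the action of the subject and period matrices\<close>

lemma X_S_carrier [simp]: "X_S d \<in> carrier_mat (dim_col d * dim_row d) (dim_col d)"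
  by (simp add: X_S_def kron_def ones_col_def)

lemma X_P_carrier [simp]: "X_P d \<in> carrier_mat (dim_col d * dim_row d) (dim_row d)"
  by (simp add: X_P_def kron_def ones_col_def)

lemma X_D_carrier [simp]: "X_D t d \<in> carrier_mat (dim_col d * dim_row d) t"
  by (simp add: X_D_def)

lemma X_C_carrier [simp]: "X_C t d \<in> carrier_mat (dim_col d * dim_row d) t"
  by (simp add: X_C_def)

lemma ones_col_carrier [simp]: "ones_col n \<in> carrier_mat n 1"
  by (simp add: ones_col_def)

lemmas [simp] =
  X_S_carrier[THEN carrier_matD(1)] X_S_carrier[THEN carrier_matD(2)]
  X_P_carrier[THEN carrier_matD(1)] X_P_carrier[THEN carrier_matD(2)]
  X_D_carrier[THEN carrier_matD(1)] X_D_carrier[THEN carrier_matD(2)]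
  X_C_carrier[THEN carrier_matD(1)] X_C_carrier[THEN carrier_matD(2)]
  ones_col_carrier[unfolded One_nat_def]

lemma X_S_index: "i < dim_col d \<Longrightarrow> k < dim_row d \<Longrightarrow> j < dim_col d \<Longrightarrow>
    X_S d $$ (i * dim_row d + k, j) = (if i = j then 1 else 0)"
  using grid_less[of i "dim_col d" k "dim_row d"] by (simp add: X_S_def kron_def ones_col_def)

lemma X_P_index: "i < dim_col d \<Longrightarrow> k < dim_row d \<Longrightarrow> j < dim_row d \<Longrightarrow>
    X_P d $$ (i * dim_row d + k, j) = (if k = j then 1 else 0)"
  using grid_less[of i "dim_col d" k "dim_row d"] by (simp add: X_P_def kron_def ones_col_def)

lemma transpose_X_S_mult_index:
  assumes "w \<in> carrier_vec (dim_col d * dim_row d)" "i < dim_col d"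
  shows "(transpose_mat (X_S d) *\<^sub>v w) $ i = (\<Sum>k<dim_row d. w $ (i * dim_row d + k))"
proof -
  have "(transpose_mat (X_S d) *\<^sub>v w) $ i = (\<Sum>l<dim_col d * dim_row d. X_S d $$ (l, i) * w $ l)"
    using assms carrier_matD[OF X_S_carrier[of d]] by (simp add: scalar_prod_def lessThan_atLeast0)
  also have "\<dots> = (\<Sum>j<dim_col d. if j = i then (\<Sum>k<dim_row d. w $ (j * dim_row d + k)) else 0)"
    unfolding sum_grid using assms by (intro sum.cong) (auto simp: X_S_index)
  finally show ?thesis
    using assms by simp
qed

lemma transpose_X_P_mult_index:
  assumes "w \<in> carrier_vec (dim_col d * dim_row d)" "k < dim_row d"
  shows "(transpose_mat (X_P d) *\<^sub>v w) $ k = (\<Sum>i<dim_col d. w $ (i * dim_row d + k))"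
proof -
  have "(transpose_mat (X_P d) *\<^sub>v w) $ k = (\<Sum>l<dim_col d * dim_row d. X_P d $$ (l, k) * w $ l)"
    using assms carrier_matD[OF X_P_carrier[of d]] by (simp add: scalar_prod_def lessThan_atLeast0)
  also have "\<dots> = (\<Sum>i<dim_col d. \<Sum>j<dim_row d. if j = k then w $ (i * dim_row d + j) else 0)"
    unfolding sum_grid using assms by (intro sum.cong) (auto simp: X_P_index)
  finally show ?thesis
    using assms by simp
qed

text \<open>Every term of the information matrices can be brought to the shape A' L L' B. The
  choices of \<open>L\<close> are the identity, the all-ones column, \<open>X_S d\<close> and
  \<open>X_P d\<close>.\<close>

lemma gram_form:
  fixes A B L :: "real mat"
  assumes A: "A \<in> carrier_mat n t" and B: "B \<in> carrier_mat n t" and L: "L \<in> carrier_mat n q"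
    and x: "x \<in> carrier_vec t" and y: "y \<in> carrier_vec t"
  shows "x \<bullet> ((transpose_mat A * L * (transpose_mat L * B)) *\<^sub>v y) =
    (transpose_mat L *\<^sub>v (A *\<^sub>v x)) \<bullet> (transpose_mat L *\<^sub>v (B *\<^sub>v y))"
proof -
  define w where "w = transpose_mat L *\<^sub>v (B *\<^sub>v y)"
  have w: "w \<in> carrier_vec q" using B L y by (simp add: w_def)
  have "(transpose_mat A * L * (transpose_mat L * B)) *\<^sub>v y = transpose_mat A *\<^sub>v (L *\<^sub>v w)"
    unfolding w_def using A B L y
    by (simp add: assoc_mult_mat_vec[of _ t q _ t] assoc_mult_mat_vec[of _ q n _ t] assoc_mult_mat_vec[of _ t n _ q])
  then have "x \<bullet> ((transpose_mat A * L * (transpose_mat L * B)) *\<^sub>v y) = (transpose_mat A *\<^sub>v (L *\<^sub>v w)) \<bullet> x"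
    using A L w x by (metis comm_scalar_prod mult_mat_vec_carrier transpose_carrier_mat)
  also have "\<dots> = (L *\<^sub>v w) \<bullet> (A *\<^sub>v x)"
    using A L w x by (intro transpose_vec_mult_scalar) auto
  also have "\<dots> = (A *\<^sub>v x) \<bullet> (L *\<^sub>v w)"
    using A L w x by (metis comm_scalar_prod mult_mat_vec_carrier)
  also have "\<dots> = (transpose_mat L *\<^sub>v (A *\<^sub>v x)) \<bullet> w"
    using A L w x by (intro transpose_vec_mult_scalar[symmetric]) auto
  finally show ?thesis unfolding w_def .
qed

text \<open>One computation for all three blocks: \<open>A\<close> and \<open>B\<close> each become
  \<open>X_D t d\<close> or \<open>X_C t d\<close>.\<close>

lemma adjusted_form_matrix:
  fixes A B :: "real mat"
  defines "r \<equiv> \<lambda>d X. N X (X_S d) * ones_col (dim_col d)"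
  assumes A: "A \<in> carrier_mat (dim_col d * dim_row d) t"
    and B: "B \<in> carrier_mat (dim_col d * dim_row d) t"
    and x: "x \<in> carrier_vec t" and y: "y \<in> carrier_vec t"
  shows "x \<bullet> ((N A B + (1 / (real (dim_row d) * real (dim_col d))) \<cdot>\<^sub>m (r d A * transpose_mat (r d B))
       - (1 / real (dim_row d)) \<cdot>\<^sub>m (N A (X_S d) * N (X_S d) B)
       - (1 / real (dim_col d)) \<cdot>\<^sub>m (N A (X_P d) * N (X_P d) B)) *\<^sub>v y) =
     adjusted_form (dim_row d) (dim_col d)
       (\<lambda>k i. (A *\<^sub>v x) $ (i * dim_row d + k)) (\<lambda>k i. (B *\<^sub>v y) $ (i * dim_row d + k))"
proof -
  define s p where "s = dim_col d" and "p = dim_row d"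
  define n where "n = s * p"
  define u v where "u = A *\<^sub>v x" and "v = B *\<^sub>v y"
  have uv: "u \<in> carrier_vec n" "v \<in> carrier_vec n"
    using A B x y by (simp_all add: u_def v_def n_def s_def p_def)
  have AB: "A \<in> carrier_mat n t" "B \<in> carrier_mat n t"
    using A B by (simp_all add: n_def s_def p_def)
  have S: "X_S d \<in> carrier_mat n s" and P: "X_P d \<in> carrier_mat n p"
    by (simp_all add: n_def s_def p_def)
  \<comment> \<open>Each row of \<open>X_S d\<close> has a single 1, so \<open>E\<close> is the
    all-ones column. Then r = A' E, which makes the product of the two replication vectors a case of
    \<open>gram_form\<close>.\<close>
  define E where "E = X_S d * ones_col s"
  have E: "E \<in> carrier_mat n 1" unfolding E_def using S ones_col_carrier by (rule mult_carrier_mat)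
  have E_mult: "(transpose_mat E *\<^sub>v w) $ 0 = (\<Sum>i<s. \<Sum>k<p. w $ (i * p + k))"
    if w: "w \<in> carrier_vec n" for w
  proof -
    have "transpose_mat E *\<^sub>v w = transpose_mat (ones_col s) *\<^sub>v (transpose_mat (X_S d) *\<^sub>v w)"
      unfolding E_def using S w
      unfolding transpose_mult[OF S ones_col_carrier]
      by (intro assoc_mult_mat_vec[of _ 1 s _ n]) (simp_all del: One_nat_def)
    also have "\<dots> $ 0 = (\<Sum>i<s. (transpose_mat (X_S d) *\<^sub>v w) $ i)"
    proof -
      have "(transpose_mat (ones_col s) *\<^sub>v w') $ 0 = (\<Sum>i<s. w' $ i)"
        if "w' \<in> carrier_vec s" for w'
        using that by (simp add: ones_col_def scalar_prod_def lessThan_atLeast0)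
      then show ?thesis
        using S w by (metis mult_mat_vec_carrier transpose_carrier_mat)
    qed
    also have "\<dots> = (\<Sum>i<s. \<Sum>k<p. w $ (i * p + k))"
      using w unfolding s_def p_def n_def by (intro sum.cong refl transpose_X_S_mult_index) auto
    finally show ?thesis .
  qed
  have rr: "r d A * transpose_mat (r d B) = transpose_mat A * E * (transpose_mat E * B)"
  proof -
    have "r d X = transpose_mat X * E" if "X \<in> carrier_mat n t" for X
      unfolding r_def N_def E_def s_def[symmetric]
      using that S by (intro assoc_mult_mat[of _ t n _ s _ 1]) auto
    moreover have "transpose_mat (transpose_mat B * E) = transpose_mat E * B"
      using AB E by (simp add: transpose_mult[of _ t n _ 1])
    ultimately show ?thesis using AB by simp
  qed
  have c: "N A B \<in> carrier_mat t t" "N A (X_S d) * N (X_S d) B \<in> carrier_mat t t"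
    "N A (X_P d) * N (X_P d) B \<in> carrier_mat t t" "r d A * transpose_mat (r d B) \<in> carrier_mat t t"
    using AB S P E unfolding rr by (auto simp: N_def)
  have 1: "x \<bullet> (N A B *\<^sub>v y) = (\<Sum>i<s. \<Sum>k<p. u $ (i * p + k) * v $ (i * p + k))"
  proof -
    have "x \<bullet> (N A B *\<^sub>v y) = u \<bullet> v"
      using gram_form[OF AB one_carrier_mat x y] AB uv by (simp add: N_def u_def v_def)
    also have "\<dots> = (\<Sum>l<n. u $ l * v $ l)"
      using uv by (simp add: scalar_prod_def lessThan_atLeast0)
    finally show ?thesis by (simp add: n_def sum_grid)
  qed
  have 2: "x \<bullet> ((r d A * transpose_mat (r d B)) *\<^sub>v y) =
      (\<Sum>i<s. \<Sum>k<p. u $ (i * p + k)) * (\<Sum>i<s. \<Sum>k<p. v $ (i * p + k))"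
    unfolding rr gram_form[OF AB E x y] using E uv
    by (simp add: scalar_prod_def E_mult u_def[symmetric] v_def[symmetric] del: index_mult_mat_vec)
  have 3: "x \<bullet> ((N A (X_S d) * N (X_S d) B) *\<^sub>v y) =
      (\<Sum>i<s. (\<Sum>k<p. u $ (i * p + k)) * (\<Sum>k<p. v $ (i * p + k)))"
    unfolding N_def gram_form[OF AB S x y] u_def[symmetric] v_def[symmetric] using S uv
    by (simp add: scalar_prod_def transpose_X_S_mult_index n_def s_def p_def lessThan_atLeast0 del: index_mult_mat_vec)
  have 4: "x \<bullet> ((N A (X_P d) * N (X_P d) B) *\<^sub>v y) =
      (\<Sum>k<p. (\<Sum>i<s. u $ (i * p + k)) * (\<Sum>i<s. v $ (i * p + k)))"
    unfolding N_def gram_form[OF AB P x y] u_def[symmetric] v_def[symmetric] using P uv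
    by (simp add: scalar_prod_def transpose_X_P_mult_index n_def s_def p_def lessThan_atLeast0 del: index_mult_mat_vec)
  have add: "x \<bullet> ((M + M') *\<^sub>v y) = x \<bullet> (M *\<^sub>v y) + x \<bullet> (M' *\<^sub>v y)"
    and minus: "x \<bullet> ((M - M') *\<^sub>v y) = x \<bullet> (M *\<^sub>v y) - x \<bullet> (M' *\<^sub>v y)"
    if "M \<in> carrier_mat t t" "M' \<in> carrier_mat t t" for M M'
    using that x y
    by (simp_all add: add_mult_distrib_mat_vec[of _ t t] minus_mult_distrib_mat_vec[of _ t t]
        scalar_prod_add_distrib[of _ t] scalar_prod_minus_distrib[of _ t])
  have smult: "x \<bullet> ((a \<cdot>\<^sub>m M) *\<^sub>v y) = a * (x \<bullet> (M *\<^sub>v y))"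
    if "M \<in> carrier_mat t t" for M a
  proof -
    have "(a \<cdot>\<^sub>m M) *\<^sub>v y = a \<cdot>\<^sub>v (M *\<^sub>v y)"
      using that y by (intro eq_vecI) auto
    then show ?thesis using that x y by simp
  qed
  show ?thesis
    unfolding adjusted_form_def s_def[symmetric] p_def[symmetric] u_def[symmetric] v_def[symmetric]
    using c by (simp only: add minus smult 1 2 3 4 add_carrier_mat minus_carrier_mat smult_carrier_mat)
qed

section \<open>Properties of the adjusted inner product\<close>

lemma adjusted_form_commute: "adjusted_form p s f h = adjusted_form p s h f"
  unfolding adjusted_form_def by (simp add: mult.commute)

lemma adjusted_form_cong:
  assumes "\<And>k i. k < p \<Longrightarrow> i < s \<Longrightarrow> f k i = f' k i" "\<And>k i. k < p \<Longrightarrow> i < s \<Longrightarrow> h k i = h' k i"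
  shows "adjusted_form p s f h = adjusted_form p s f' h'"
  unfolding adjusted_form_def using assms by simp

text \<open>A function of the period alone lies in the space that is projected out.\<close>

lemma adjusted_form_period_effect:
  assumes "p > 0" "s > 0"
  shows "adjusted_form p s f (\<lambda>k i. c k) = 0"
proof -
  define T where "T = (\<Sum>i<s. \<Sum>k<p. f k i)"
  define W where "W = (\<Sum>k<p. (\<Sum>i<s. f k i) * c k)"
  have 1: "(\<Sum>i<s. \<Sum>k<p. f k i * c k) = W"
    unfolding W_def by (subst sum.swap) (simp add: sum_distrib_right)
  have 2: "(\<Sum>i<s. \<Sum>k<p. c k) = real s * sum c {..<p}"
    by simp
  have 3: "(\<Sum>i<s. (\<Sum>k<p. f k i) * sum c {..<p}) = T * sum c {..<p}"
    unfolding T_def by (rule sum_distrib_right[symmetric])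
  have 4: "(\<Sum>k<p. (\<Sum>i<s. f k i) * (\<Sum>i<s. c k)) = real s * W"
    unfolding W_def sum_distrib_left by (simp add: mult_ac)
  show ?thesis
    using assms unfolding adjusted_form_def 1 2 3 4 T_def[symmetric] by simp
qed

text \<open>Vanishing period totals of \<open>f\<close> alone remove the period term and the grand
  total; \<open>h\<close> can be arbitrary.\<close>

lemma adjusted_form_zero_period_sums:
  assumes "\<And>k. k < p \<Longrightarrow> (\<Sum>i<s. f k i) = 0"
  shows "adjusted_form p s f h =
    (\<Sum>i<s. \<Sum>k<p. f k i * h k i) - 1 / real p * (\<Sum>i<s. (\<Sum>k<p. f k i) * (\<Sum>k<p. h k i))"
proof -
  have "(\<Sum>i<s. \<Sum>k<p. f k i) = 0"
    using assms by (subst sum.swap) simp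
  then show ?thesis
    unfolding adjusted_form_def using assms by simp
qed

text \<open>\<open>direct d x\<close> and \<open>carry_over d x\<close> are the vectors
  \<open>X_D t d *\<^sub>v x\<close> and \<open>X_C t d *\<^sub>v x\<close>, read as functions of
  period and subject.\<close>

definition direct :: "design \<Rightarrow> real vec \<Rightarrow> nat \<Rightarrow> nat \<Rightarrow> real" where
  "direct d x k i = x $ (d $$ (k,i))"

definition carry_over :: "design \<Rightarrow> real vec \<Rightarrow> nat \<Rightarrow> nat \<Rightarrow> real" where
  "carry_over d x k i = (if k = 0 then 0 else x $ (d $$ (k - 1,i)))"

lemma X_D_index: "i < dim_col d \<Longrightarrow> k < dim_row d \<Longrightarrow> a < t \<Longrightarrow>
    X_D t d $$ (i * dim_row d + k, a) = (if d $$ (k,i) = a then 1 else 0)"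
  using grid_less[of i "dim_col d" k "dim_row d"] by (simp add: X_D_def)

lemma X_C_index: "i < dim_col d \<Longrightarrow> k < dim_row d \<Longrightarrow> a < t \<Longrightarrow>
    X_C t d $$ (i * dim_row d + k, a) = (if 1 \<le> k \<and> d $$ (k - 1,i) = a then 1 else 0)"
  using grid_less[of i "dim_col d" k "dim_row d"] by (simp add: X_C_def)

lemma X_D_mult_index:
  assumes "is_design p s t d" "x \<in> carrier_vec t" "i < s" "k < p"
  shows "(X_D t d *\<^sub>v x) $ (i * p + k) = direct d x k i"
proof -
  have d: "dim_row d = p" "dim_col d = s" "d $$ (k,i) < t"
    using assms by (auto simp: is_design_def)
  have "(X_D t d *\<^sub>v x) $ (i * p + k) = (\<Sum>a<t. X_D t d $$ (i * p + k, a) * x $ a)"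
    using assms grid_less[of i s k p] by (simp add: d scalar_prod_def lessThan_atLeast0)
  also have "\<dots> = (\<Sum>a<t. if d $$ (k,i) = a then x $ a else 0)"
    using assms X_D_index[of i d k] by (intro sum.cong) (auto simp: d)
  finally show ?thesis
    using d by (simp add: direct_def)
qed

lemma X_C_mult_index:
  assumes "is_design p s t d" "x \<in> carrier_vec t" "i < s" "k < p"
  shows "(X_C t d *\<^sub>v x) $ (i * p + k) = carry_over d x k i"
proof -
  have d: "dim_row d = p" "dim_col d = s" "d $$ (k - 1,i) < t"
    using assms by (auto simp: is_design_def)
  have "(X_C t d *\<^sub>v x) $ (i * p + k) = (\<Sum>a<t. X_C t d $$ (i * p + k, a) * x $ a)"
    using assms grid_less[of i s k p] by (simp add: d scalar_prod_def lessThan_atLeast0)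
  \<comment> \<open>In the first period truncated subtraction gives k - 1 = 0, which still points to
    a treatment below \<open>t\<close>. Writing \<open>carry_over d x k i\<close> for the summand
    makes the selected value 0 there, as it should be.\<close>
  also have "\<dots> = (\<Sum>a<t. if d $$ (k - 1,i) = a then carry_over d x k i else 0)"
    using assms X_C_index[of i d k] by (intro sum.cong) (auto simp: d carry_over_def)
  finally show ?thesis
    using d by simp
qed

text \<open>The assumption \<open>rows\<close> says that each row is 0-1 with at most one 1. So
  distinct columns are orthogonal, and the diagonal of X'X holds the column totals, which are the
  replications. This puts the diagonal terms into the form that \<open>adjusted_form_matrix\<close>
  expects.\<close>

lemma diag_replication_eq_gram:
  fixes X :: "real mat"
  assumes X: "X \<in> carrier_mat (dim_col d * dim_row d) t"
    and rows: "\<And>i k a b. i < dim_col d \<Longrightarrow> k < dim_row d \<Longrightarrow> a < t \<Longrightarrow> b < t \<Longrightarrow>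
      X $$ (i * dim_row d + k, a) * X $$ (i * dim_row d + k, b) =
        (if a = b then X $$ (i * dim_row d + k, a) else 0)"
  shows "mat_diag t (\<lambda>a. (N X (X_S d) * ones_col (dim_col d)) $$ (a,0)) = N X X"
proof (rule eq_matI)
  define n where "n = dim_col d * dim_row d"
  have X': "X \<in> carrier_mat n t" "dim_row X = n" "dim_col X = t" using X by (auto simp: n_def)
  fix a b assume "a < dim_row (N X X)" "b < dim_col (N X X)"
  then have ab: "a < t" "b < t" using X by (auto simp: N_def)
  have ones: "(X_S d * ones_col (dim_col d)) $$ (i * dim_row d + k, 0) = 1"
    if "i < dim_col d" "k < dim_row d" for i k
  proof -
    have "(X_S d * ones_col (dim_col d)) $$ (i * dim_row d + k, 0) =
        (\<Sum>j<dim_col d. X_S d $$ (i * dim_row d + k, j))"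
      using that grid_less[of i "dim_col d" k "dim_row d"]
      by (simp add: ones_col_def scalar_prod_def lessThan_atLeast0)
    then show ?thesis using that by (simp add: X_S_index)
  qed
  have NXX: "N X X $$ (a,b) = (\<Sum>i<dim_col d. \<Sum>k<dim_row d.
      X $$ (i * dim_row d + k, a) * X $$ (i * dim_row d + k, b))"
    unfolding sum_grid[symmetric, of "\<lambda>l. X $$ (l, a) * X $$ (l, b)"]
    using ab X' by (simp add: N_def scalar_prod_def lessThan_atLeast0 n_def)
  have "N X (X_S d) * ones_col (dim_col d) = transpose_mat X * (X_S d * ones_col (dim_col d))"
    unfolding N_def using X by (intro assoc_mult_mat[of _ t n _ "dim_col d" _ 1]) (auto simp: n_def)
  then have r: "(N X (X_S d) * ones_col (dim_col d)) $$ (a,0) =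
      (\<Sum>i<dim_col d. \<Sum>k<dim_row d. X $$ (i * dim_row d + k, a) *
        (X_S d * ones_col (dim_col d)) $$ (i * dim_row d + k, 0))"
    unfolding sum_grid[symmetric, of "\<lambda>l. X $$ (l, a) * (X_S d * ones_col (dim_col d)) $$ (l, 0)"]
    using ab X' by (simp add: scalar_prod_def lessThan_atLeast0 n_def ones_col_def)
  have diag: "(N X (X_S d) * ones_col (dim_col d)) $$ (a,0) =
      (\<Sum>i<dim_col d. \<Sum>k<dim_row d. X $$ (i * dim_row d + k, a))"
    unfolding r by (intro sum.cong refl) (simp add: ones del: index_mult_mat)
  have gram: "N X X $$ (a,b) = (\<Sum>i<dim_col d. \<Sum>k<dim_row d.
      if a = b then X $$ (i * dim_row d + k, a) else 0)"
    unfolding NXX using ab rows by (intro sum.cong refl) simp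
  have "mat_diag t f $$ (a,b) = (if a = b then f a else 0)" for f :: "nat \<Rightarrow> real"
    using ab by (simp add: mat_diag_def)
  then show "mat_diag t (\<lambda>a. (N X (X_S d) * ones_col (dim_col d)) $$ (a,0)) $$ (a,b) = N X X $$ (a,b)"
    by (simp only: diag gram) auto
qed (use X in \<open>auto simp: N_def mat_diag_def\<close>)

lemma
  assumes d: "is_design p s t d" and x: "x \<in> carrier_vec t" and y: "y \<in> carrier_vec t"
  shows C11_form: "x \<bullet> (C11 t d *\<^sub>v y) = adjusted_form p s (direct d x) (direct d y)"
    and C12_form: "x \<bullet> (C12 t d *\<^sub>v y) = adjusted_form p s (direct d x) (carry_over d y)"
    and C22_form: "x \<bullet> (C22 t d *\<^sub>v y) = adjusted_form p s (carry_over d x) (carry_over d y)"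
proof -
  have dims: "dim_row d = p" "dim_col d = s" using d by (auto simp: is_design_def)
  have D: "mat_diag t (\<lambda>a. r_D t d $$ (a,0)) = N (X_D t d) (X_D t d)"
    unfolding r_D_def by (rule diag_replication_eq_gram) (auto simp: X_D_index)
  have C: "mat_diag t (\<lambda>a. r_C t d $$ (a,0)) = N (X_C t d) (X_C t d)"
    unfolding r_C_def by (rule diag_replication_eq_gram) (auto simp: X_C_index)
  show "x \<bullet> (C11 t d *\<^sub>v y) = adjusted_form p s (direct d x) (direct d y)"
    unfolding C11_def Let_def D unfolding r_D_def
    unfolding adjusted_form_matrix[OF X_D_carrier X_D_carrier x y]
    unfolding dims by (rule adjusted_form_cong)
      (simp_all add: X_D_mult_index[OF d x] X_D_mult_index[OF d y] dims del: index_mult_mat_vec)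
  show "x \<bullet> (C12 t d *\<^sub>v y) = adjusted_form p s (direct d x) (carry_over d y)"
    unfolding C12_def Let_def r_D_def r_C_def
    unfolding adjusted_form_matrix[OF X_D_carrier X_C_carrier x y]
    unfolding dims by (rule adjusted_form_cong)
      (simp_all add: X_D_mult_index[OF d x] X_C_mult_index[OF d y] dims del: index_mult_mat_vec)
  show "x \<bullet> (C22 t d *\<^sub>v y) = adjusted_form p s (carry_over d x) (carry_over d y)"
    unfolding C22_def Let_def C unfolding r_C_def
    unfolding adjusted_form_matrix[OF X_C_carrier X_C_carrier x y]
    unfolding dims by (rule adjusted_form_cong)
      (simp_all add: X_C_mult_index[OF d x] X_C_mult_index[OF d y] dims del: index_mult_mat_vec)
qed

section \<open>Dimensions, and recognising symmetric matrices and zero vectors by scalar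
  products\<close>

lemma N_carrier: "A \<in> carrier_mat n t \<Longrightarrow> B \<in> carrier_mat n u \<Longrightarrow> N A B \<in> carrier_mat t u"
  unfolding N_def by (rule mult_carrier_mat[of _ _ n]) auto

lemma C_carrier [simp]:
  "C11 t d \<in> carrier_mat t t" "C12 t d \<in> carrier_mat t t" "C22 t d \<in> carrier_mat t t"
  unfolding C11_def C12_def C22_def Let_def
  by (intro minus_carrier_mat smult_carrier_mat mult_carrier_mat[of _ _ "dim_row d"]
      N_carrier[of _ "dim_col d * dim_row d"] X_D_carrier X_C_carrier X_P_carrier)+

lemma symmetric_matI:
  fixes M :: "real mat"
  assumes M: "M \<in> carrier_mat n n"
    and sym: "\<And>x y. x \<in> carrier_vec n \<Longrightarrow> y \<in> carrier_vec n \<Longrightarrow> x \<bullet> (M *\<^sub>v y) = y \<bullet> (M *\<^sub>v x)"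
  shows "transpose_mat M = M"
proof (rule eq_matI)
  fix i j assume "i < dim_row M" "j < dim_col M"
  then have ij: "i < n" "j < n" using M by auto
  have "unit_vec n a \<bullet> (M *\<^sub>v unit_vec n b) = M $$ (a,b)" if "a < n" "b < n" for a b
    using that M by simp
  then show "transpose_mat M $$ (i,j) = M $$ (i,j)"
    using sym[of "unit_vec n i" "unit_vec n j"] ij M by simp
qed (use M in auto)

lemma vec_zeroI:
  fixes v :: "real vec"
  assumes "v \<in> carrier_vec n" "\<And>x. x \<in> carrier_vec n \<Longrightarrow> x \<bullet> v = 0"
  shows "v = 0\<^sub>v n"
proof (rule eq_vecI)
  fix i assume "i < dim_vec (0\<^sub>v n)"
  then show "v $ i = 0\<^sub>v n $ i"
    using assms(2)[of "unit_vec n i"] assms(1) by simp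
qed (use assms in auto)

section \<open>Estimates for a truncated balanced plan\<close>

lemma abs_sum_mult_le:
  fixes a b :: "'a \<Rightarrow> real"
  shows "\<bar>\<Sum>i\<in>I. a i * b i\<bar> \<le> sqrt (\<Sum>i\<in>I. (a i)\<^sup>2) * sqrt (\<Sum>i\<in>I. (b i)\<^sup>2)"
  using real_sqrt_le_mono[OF Cauchy_Schwarz_ineq_sum[of a b I]] by (simp add: real_sqrt_mult)

text \<open>Uniformity and balance of the full plan, restated from counts to sums of arbitrary
  functions of the treatment, which is how the estimates use them. \<open>d\<close> is the plan over
  all \<open>t\<close> periods; the first \<open>p\<close> are kept and the last \<open>m\<close>
  dropped. The matrix behind \<open>successor_sum\<close> is g (J - I).\<close>

locale balanced_plan =
  fixes t m g p :: nat and d :: "nat \<Rightarrow> nat \<Rightarrow> nat"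
  assumes t: "t = p + m" and p: "p > 0"
    and subject_sum: "\<And>(h :: nat \<Rightarrow> real) i. i < g * t \<Longrightarrow> (\<Sum>k<t. h (d k i)) = (\<Sum>a<t. h a)"
    and period_sum: "\<And>(h :: nat \<Rightarrow> real) k. k < t \<Longrightarrow> (\<Sum>i<g * t. h (d k i)) = g * (\<Sum>a<t. h a)"
    and successor_sum: "\<And>x y :: nat \<Rightarrow> real.
      (\<Sum>k<t - 1. \<Sum>i<g * t. x (d (Suc k) i) * y (d k i)) =
        g * ((\<Sum>a<t. x a) * (\<Sum>a<t. y a) - (\<Sum>a<t. x a * y a))"
begin

abbreviation sq :: "(nat \<Rightarrow> real) \<Rightarrow> real" where "sq x \<equiv> \<Sum>a<t. (x a)\<^sup>2"

abbreviation carry :: "(nat \<Rightarrow> real) \<Rightarrow> nat \<Rightarrow> nat \<Rightarrow> real" where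
  "carry x k i \<equiv> (if k = 0 then 0 else x (d (k - 1) i))"

text \<open>Cauchy-Schwarz over the t - q last periods of each subject costs one factor t - q. The
  squares then add up to \<open>g * sq x\<close> in each of these periods, which gives the second
  factor.\<close>

lemma tail_square_sum:
  assumes "q \<le> t"
  shows "(\<Sum>i<g * t. (\<Sum>k\<in>{q..<t}. x (d k i))\<^sup>2) \<le> g * (real (t - q))\<^sup>2 * sq x"
proof -
  have "(\<Sum>i<g * t. (\<Sum>k\<in>{q..<t}. x (d k i))\<^sup>2) \<le> (\<Sum>i<g * t. (\<Sum>k\<in>{q..<t}. (x (d k i))\<^sup>2) * real (t - q))"
    using sum_squared_le_sum_of_squares[of "\<lambda>k. x (d k _)" "{q..<t}"] by (intro sum_mono) simp
  also have "\<dots> = (\<Sum>k\<in>{q..<t}. \<Sum>i<g * t. (x (d k i))\<^sup>2) * real (t - q)"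
    by (subst sum.swap) (simp add: sum_distrib_right)
  also have "(\<Sum>k\<in>{q..<t}. \<Sum>i<g * t. (x (d k i))\<^sup>2) = (\<Sum>k\<in>{q..<t}. g * sq x)"
    by (intro sum.cong refl period_sum[of _ "\<lambda>a. (x a)\<^sup>2"]) simp
  finally show ?thesis
    by (simp add: power2_eq_square mult_ac)
qed

lemma head_sum:
  fixes x :: "nat \<Rightarrow> real"
  assumes "(\<Sum>a<t. x a) = 0" "q \<le> t" "i < g * t"
  shows "(\<Sum>k<q. x (d k i)) = - (\<Sum>k\<in>{q..<t}. x (d k i))"
proof -
  have "(\<Sum>k<q. x (d k i)) + (\<Sum>k\<in>{q..<t}. x (d k i)) = (\<Sum>k<t. x (d k i))"
    using \<open>q \<le> t\<close> by (simp add: lessThan_atLeast0 sum.atLeastLessThan_concat)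
  then show ?thesis
    using subject_sum[OF \<open>i < g * t\<close>, of x] assms(1) by simp
qed

text \<open>A long head is exchanged for a short tail. It is applied with q = p, where t - q = m,
  and with q = p - 1, where t - q = m + 1.\<close>

lemma head_square_sum:
  fixes x :: "nat \<Rightarrow> real"
  assumes "(\<Sum>a<t. x a) = 0" "q \<le> t"
  shows "(\<Sum>i<g * t. (\<Sum>k<q. x (d k i))\<^sup>2) \<le> g * (real (t - q))\<^sup>2 * sq x"
  using tail_square_sum[OF assms(2), of x] by (simp add: head_sum[OF assms])

lemma carry_sum: "(\<Sum>k<p. f k * carry x k i) = (\<Sum>k<p - 1. f (Suc k) * x (d k i))"
proof -
  obtain q where "p = Suc q" using p gr0_implies_Suc by auto
  then show ?thesis by (simp add: sum.lessThan_Suc_shift del: sum.lessThan_Suc)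
qed

lemma period_sum_zero:
  fixes x :: "nat \<Rightarrow> real"
  assumes "(\<Sum>a<t. x a) = 0" "k < p"
  shows "(\<Sum>i<g * t. x (d k i)) = 0" "(\<Sum>i<g * t. carry x k i) = 0"
proof -
  have *: "(\<Sum>i<g * t. x (d j i)) = 0" if "j < t" for j
    using period_sum[OF that, of x] assms by simp
  show "(\<Sum>i<g * t. x (d k i)) = 0" using * assms t by simp
  show "(\<Sum>i<g * t. carry x k i) = 0" using *[of "k - 1"] assms t by (cases k) simp_all
qed

text \<open>The sum of squares is exactly p g |x|^2, and the period terms vanish. Only the subject
  totals reduce it, by at most g m^2/p times |x|^2.\<close>

lemma direct_form_ge:
  assumes x: "(\<Sum>a<t. x a) = 0"
  shows "adjusted_form p (g * t) (\<lambda>k i. x (d k i)) (\<lambda>k i. x (d k i)) \<ge> g * (p - m\<^sup>2 / p) * sq x"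
proof -
  have "(\<Sum>i<g * t. \<Sum>k<p. x (d k i) * x (d k i)) = (\<Sum>k<p. g * sq x)"
    unfolding power2_eq_square[symmetric]
    by (subst sum.swap, intro sum.cong refl period_sum[of _ "\<lambda>a. (x a)\<^sup>2"]) (simp add: t)
  moreover have "(\<Sum>i<g * t. (\<Sum>k<p. x (d k i)) * (\<Sum>k<p. x (d k i))) \<le> g * (real m)\<^sup>2 * sq x"
    using head_square_sum[OF x, of p] t by (simp add: power2_eq_square)
  then have "1 / real p * (\<Sum>i<g * t. (\<Sum>k<p. x (d k i)) * (\<Sum>k<p. x (d k i))) \<le> 1 / real p * (g * (real m)\<^sup>2 * sq x)"
    by (rule mult_left_mono) simp
  ultimately show ?thesis
    using period_sum_zero[OF x] by (simp add: adjusted_form_zero_period_sums algebra_simps)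
qed

text \<open>Carry-over is absent in the first period, and the treatment of the last kept period has
  no observed successor. Hence only p - 1 periods contribute squares, and the subject totals are
  heads of length p - 1, whose tails have length m + 1.\<close>

lemma carry_form_ge:
  assumes x: "(\<Sum>a<t. x a) = 0"
  shows "adjusted_form p (g * t) (carry x) (carry x) \<ge> g * (real p - 1 - (real m + 1)\<^sup>2 / p) * sq x"
proof -
  have carry: "(\<Sum>k<p. carry x k i) = (\<Sum>k<p - 1. x (d k i))" for i
    using carry_sum[of "\<lambda>_. 1"] by simp
  have "(\<Sum>i<g * t. \<Sum>k<p. carry x k i * carry x k i) = (\<Sum>i<g * t. \<Sum>k<p - 1. (x (d k i))\<^sup>2)"
    by (subst carry_sum) (simp add: power2_eq_square)
  also have "\<dots> = (\<Sum>k<p - 1. g * sq x)"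
    by (subst sum.swap, intro sum.cong refl period_sum[of _ "\<lambda>a. (x a)\<^sup>2"]) (simp add: t)
  finally have 1: "(\<Sum>i<g * t. \<Sum>k<p. carry x k i * carry x k i) = (real p - 1) * (g * sq x)"
    using p by (simp add: of_nat_diff)
  have "(\<Sum>i<g * t. (\<Sum>k<p. carry x k i) * (\<Sum>k<p. carry x k i)) \<le> g * (real m + 1)\<^sup>2 * sq x"
    unfolding carry using head_square_sum[OF x, of "p - 1"] t p
    by (simp add: power2_eq_square[symmetric] of_nat_diff algebra_simps)
  then have "1 / real p * (\<Sum>i<g * t. (\<Sum>k<p. carry x k i) * (\<Sum>k<p. carry x k i)) \<le> 1 / real p * (g * (real m + 1)\<^sup>2 * sq x)"
    by (rule mult_left_mono) simp
  moreover have "adjusted_form p (g * t) (carry x) (carry x) =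
      (real p - 1) * (g * sq x) - 1 / real p * (\<Sum>i<g * t. (\<Sum>k<p. carry x k i) * (\<Sum>k<p. carry x k i))"
    using period_sum_zero(2)[OF x] unfolding 1[symmetric] by (rule adjusted_form_zero_period_sums)
  ultimately show ?thesis
    by (simp only:) (simp add: algebra_simps)
qed

text \<open>The successions contribute at most m + 1 times \<open>g * R\<close>: once for the full
  plan, where balance leaves -g times the product of \<open>x\<close> and \<open>y\<close>, and once
  for each of the m dropped successions. The subject totals add m (m + 1) / p times
  \<open>g * R\<close>.\<close>

lemma mixed_form_le:
  assumes x: "(\<Sum>a<t. x a) = 0" and y: "(\<Sum>a<t. y a) = 0"
  shows "\<bar>adjusted_form p (g * t) (\<lambda>k i. x (d k i)) (carry y)\<bar> \<le>
    g * ((real m + 1) * t / p) * (sqrt (sq x) * sqrt (sq y))"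
proof -
  define R where "R = sqrt (sq x) * sqrt (sq y)"
  define succ where "succ k = (\<Sum>i<g * t. x (d (Suc k) i) * y (d k i))" for k
  define cross where "cross = (\<Sum>i<g * t. (\<Sum>k<p. x (d k i)) * (\<Sum>k<p - 1. y (d k i)))"
  have form: "adjusted_form p (g * t) (\<lambda>k i. x (d k i)) (carry y) =
      (\<Sum>k<p - 1. succ k) - 1 / real p * cross"
  proof -
    have "(\<Sum>k<p. carry y k i) = (\<Sum>k<p - 1. y (d k i))" for i
      using carry_sum[of "\<lambda>_. 1"] by simp
    moreover have "(\<Sum>i<g * t. \<Sum>k<p. x (d k i) * carry y k i) = (\<Sum>k<p - 1. succ k)"
      unfolding succ_def carry_sum[of "\<lambda>k. x (d k _)"] by (rule sum.swap)
    ultimately show ?thesis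
      using adjusted_form_zero_period_sums[OF period_sum_zero(1)[OF x], where h = "carry y"]
      unfolding cross_def by simp
  qed
  have "\<bar>succ k\<bar> \<le> g * R" if "k < t - 1" for k
  proof -
    have "\<bar>succ k\<bar> \<le> sqrt (g * sq x) * sqrt (g * sq y)"
      using that abs_sum_mult_le[of "\<lambda>i. x (d (Suc k) i)" "\<lambda>i. y (d k i)" "{..<g * t}"]
        period_sum[of "Suc k" "\<lambda>a. (x a)\<^sup>2"] period_sum[of k "\<lambda>a. (y a)\<^sup>2"]
      by (simp add: succ_def)
    also have "\<dots> = (sqrt g * sqrt g) * R"
      by (simp only: R_def real_sqrt_mult mult_ac)
    finally show ?thesis by simp
  qed
  \<comment> \<open>These t - p = m indices are the successions into a dropped period.\<close>
  then have "(\<Sum>k\<in>{p - 1..<t - 1}. \<bar>succ k\<bar>) \<le> (\<Sum>k\<in>{p - 1..<t - 1}. g * R)"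
    by (intro sum_mono) simp
  then have tail: "\<bar>\<Sum>k\<in>{p - 1..<t - 1}. succ k\<bar> \<le> m * (g * R)"
    using t p by (intro order_trans[OF sum_abs]) simp
  have "(\<Sum>k<p - 1. succ k) + (\<Sum>k\<in>{p - 1..<t - 1}. succ k) = (\<Sum>k<t - 1. succ k)"
    using t by (simp add: lessThan_atLeast0 sum.atLeastLessThan_concat)
  also have "\<dots> = - (g * (\<Sum>a<t. x a * y a))"
    unfolding succ_def successor_sum x y by simp
  finally have head: "(\<Sum>k<p - 1. succ k) = - (g * (\<Sum>a<t. x a * y a)) - (\<Sum>k\<in>{p - 1..<t - 1}. succ k)"
    by simp
  have "\<bar>g * (\<Sum>a<t. x a * y a)\<bar> \<le> g * R"
    using abs_sum_mult_le[of x y "{..<t}"] by (simp add: R_def abs_mult mult_left_mono)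
  then have "\<bar>\<Sum>k<p - 1. succ k\<bar> \<le> (real m + 1) * (g * R)"
    using head tail unfolding distrib_right by linarith
  moreover have "\<bar>1 / real p * cross\<bar> \<le> 1 / real p * (g * m * (real m + 1) * R)"
  proof -
    \<comment> \<open>Direct values run over \<open>p\<close> periods and carry-over values over p -
      1, so the tails have lengths m and m + 1.\<close>
    have "\<bar>cross\<bar> \<le> sqrt (g * (real m)\<^sup>2 * sq x) * sqrt (g * (real m + 1)\<^sup>2 * sq y)"
      unfolding cross_def
      using head_square_sum[OF x, of p] head_square_sum[OF y, of "p - 1"] t p
      by (intro order_trans[OF abs_sum_mult_le] mult_mono real_sqrt_le_mono)
        (simp_all add: of_nat_diff add_ac sum_nonneg)
    also have "\<dots> = g * m * (real m + 1) * R"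
      by (simp add: real_sqrt_mult R_def mult_ac)
    finally show ?thesis
      by (simp add: abs_mult divide_right_mono)
  qed
  ultimately have "\<bar>adjusted_form p (g * t) (\<lambda>k i. x (d k i)) (carry y)\<bar> \<le>
      (real m + 1) * (g * R) + 1 / real p * (g * m * (real m + 1) * R)"
    unfolding form by linarith
  \<comment> \<open>Here 1 + m/p = t/p.\<close>
  also have "\<dots> = g * ((real m + 1) * t / p) * R"
    using p t by (simp add: field_simps)
  finally show ?thesis unfolding R_def .
qed

end

section \<open>Schur complements and their spectra\<close>

lemma scalar_prod_ones_vec: "x \<in> carrier_vec t \<Longrightarrow> ones_vec t \<bullet> x = (\<Sum>a<t. x $ a)"
  by (simp add: ones_vec_def scalar_prod_def lessThan_atLeast0)

lemma ones_vec_carrier [simp]: "ones_vec t \<in> carrier_vec t"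
  by (simp add: ones_vec_def)

lemma zero_smult_ones_vec [simp]: "0 \<cdot>\<^sub>v ones_vec n = 0\<^sub>v n"
  by (auto simp: ones_vec_def)

lemma symmetric_mat_scalar_prod:
  fixes M :: "real mat"
  assumes "M \<in> carrier_mat n n" "transpose_mat M = M" "x \<in> carrier_vec n" "y \<in> carrier_vec n"
  shows "x \<bullet> (M *\<^sub>v y) = (M *\<^sub>v x) \<bullet> y"
  using transpose_vec_mult_scalar[of M n n y x] assms by simp

text \<open>The equation A22 z = A12' x has a sum-zero solution for every x. Replacing A12' x by A22
  z on both sides of \<open>G\<close> leaves A22 G A22 = A22, so the form does not depend on the
  choice of \<open>G\<close>. Symmetry is read off this form, since \<open>G\<close> itself may be
  non-symmetric.\<close>

lemma schur_complement_form:
  fixes A11 A12 A22 G :: "real mat"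
  defines "M \<equiv> A11 - A12 * G * transpose_mat A12"
  assumes carr: "A11 \<in> carrier_mat n n" "A12 \<in> carrier_mat n n" "A22 \<in> carrier_mat n n"
    and sym: "transpose_mat A11 = A11" "transpose_mat A22 = A22"
    and ker: "A12 *\<^sub>v ones_vec n = 0\<^sub>v n" "A22 *\<^sub>v ones_vec n = 0\<^sub>v n"
    and c: "c > 0"
    and pos: "\<And>y. y \<in> carrier_vec n \<Longrightarrow> (\<Sum>a<n. y $ a) = 0 \<Longrightarrow> y \<bullet> (A22 *\<^sub>v y) \<ge> c * (y \<bullet> y)"
    and G: "gen_inverse A22 G"
  shows "transpose_mat M = M"
    and "x \<in> carrier_vec n \<Longrightarrow> \<exists>z\<in>carrier_vec n. (\<Sum>a<n. z $ a) = 0 \<and>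
      z \<bullet> (A22 *\<^sub>v z) = x \<bullet> (A12 *\<^sub>v z) \<and> x \<bullet> (M *\<^sub>v x) = x \<bullet> (A11 *\<^sub>v x) - z \<bullet> (A22 *\<^sub>v z)"
proof -
  have Gc: "G \<in> carrier_mat n n" and GG: "A22 * G * A22 = A22"
    using G carr by (auto simp: gen_inverse_def)
  have M: "M \<in> carrier_mat n n" unfolding M_def using carr Gc by (intro minus_carrier_mat) auto
  \<comment> \<open>Adding the all-ones matrix makes A22 invertible without changing it on sum-zero vectors.\<close>
  define J :: "real mat" where "J = Matrix.mat n n (\<lambda>_. 1)"
  have J: "J \<in> carrier_mat n n" by (simp add: J_def)
  have J_mult: "J *\<^sub>v v = (\<Sum>a<n. v $ a) \<cdot>\<^sub>v ones_vec n" if "v \<in> carrier_vec n" for v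
    using that by (intro eq_vecI) (simp_all add: J_def ones_vec_def scalar_prod_def lessThan_atLeast0)
  have AJ: "(A22 + J) *\<^sub>v v = A22 *\<^sub>v v + (\<Sum>a<n. v $ a) \<cdot>\<^sub>v ones_vec n" if "v \<in> carrier_vec n" for v
    using that carr J by (simp add: add_mult_distrib_mat_vec[of _ n n] J_mult)
  \<comment> \<open>Against the all-ones vector, A22 v contributes nothing and J v contributes n
    times the sum of v.\<close>
  have sum_zero: "(\<Sum>a<n. v $ a) = 0"
    if v: "v \<in> carrier_vec n" and eq: "ones_vec n \<bullet> ((A22 + J) *\<^sub>v v) = 0" for v
  proof -
    have "ones_vec n \<bullet> (A22 *\<^sub>v v) = 0"
      using v carr ker by (simp add: symmetric_mat_scalar_prod[OF carr(3) sym(2)])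
    then have "(\<Sum>a<n. v $ a) * n = 0"
      using eq v carr
      by (simp add: AJ scalar_prod_add_distrib[of _ n] scalar_prod_ones_vec) (simp add: ones_vec_def)
    then show ?thesis by (cases "n = 0") auto
  qed
  have "det (A22 + J) \<noteq> 0"
  proof
    assume "det (A22 + J) = 0"
    then obtain v where v: "v \<in> carrier_vec n" "v \<noteq> 0\<^sub>v n" and 0: "(A22 + J) *\<^sub>v v = 0\<^sub>v n"
      using det_0_iff_vec_prod_zero[of "A22 + J" n] carr J by auto
    have s: "(\<Sum>a<n. v $ a) = 0" using sum_zero[OF v(1)] 0 by simp
    have "A22 *\<^sub>v v + 0\<^sub>v n = 0\<^sub>v n"
      using AJ[OF v(1)] 0 s by simp
    then have "A22 *\<^sub>v v = 0\<^sub>v n"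
      using v carr by simp
    then have "c * (v \<bullet> v) \<le> 0" using pos[OF v(1) s] v by simp
    moreover have "v \<bullet> v > 0"
      using v conjugate_square_greater_0_vec[of v n] by simp
    ultimately show False using c by (simp add: mult_le_0_iff)
  qed
  then obtain W where W: "W \<in> carrier_mat n n" "(A22 + J) * W = 1\<^sub>m n"
    using det_non_zero_imp_unit[of "A22 + J" n] carr J
    by (auto simp: Units_def ring_mat_def)
  have "\<exists>z\<in>carrier_vec n. (\<Sum>a<n. z $ a) = 0 \<and> A22 *\<^sub>v z = transpose_mat A12 *\<^sub>v x"
    if x: "x \<in> carrier_vec n" for x
  proof -
    define z where "z = W *\<^sub>v (transpose_mat A12 *\<^sub>v x)"
    have z: "z \<in> carrier_vec n" using W carr x by (simp add: z_def)
    have eq: "(A22 + J) *\<^sub>v z = transpose_mat A12 *\<^sub>v x"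
      using W carr J x unfolding z_def
      by (subst assoc_mult_mat_vec[symmetric, of _ n n _ n]) auto
    \<comment> \<open>The right-hand side is orthogonal to the all-ones vector, so
      \<open>sum_zero\<close> applies to the solution.\<close>
    have "(transpose_mat A12 *\<^sub>v x) \<bullet> ones_vec n = 0"
      using transpose_vec_mult_scalar[OF carr(2) ones_vec_carrier x] ker x by simp
    then have s: "(\<Sum>a<n. z $ a) = 0"
      using sum_zero[OF z] eq carr x by (metis comm_scalar_prod mult_mat_vec_carrier ones_vec_carrier transpose_carrier_mat)
    then have "A22 *\<^sub>v z = transpose_mat A12 *\<^sub>v x"
      using AJ[OF z] eq carr z by simp
    then show ?thesis using z s by blast
  qed
  then obtain Z where Z: "\<And>x. x \<in> carrier_vec n \<Longrightarrow> Z x \<in> carrier_vec n"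
    "\<And>x. x \<in> carrier_vec n \<Longrightarrow> (\<Sum>a<n. Z x $ a) = 0"
    "\<And>x. x \<in> carrier_vec n \<Longrightarrow> A22 *\<^sub>v Z x = transpose_mat A12 *\<^sub>v x"
    by metis
  have form: "x \<bullet> (M *\<^sub>v y) = x \<bullet> (A11 *\<^sub>v y) - Z x \<bullet> (A22 *\<^sub>v Z y)"
    if x: "x \<in> carrier_vec n" and y: "y \<in> carrier_vec n" for x y
  proof -
    define u where "u = G *\<^sub>v (A22 *\<^sub>v Z y)"
    have u: "u \<in> carrier_vec n" using Gc carr Z(1)[OF y] by (simp add: u_def)
    have "A12 * G * transpose_mat A12 \<in> carrier_mat n n"
      using carr Gc by (intro mult_carrier_mat[of _ n n]) auto
    then have "x \<bullet> (M *\<^sub>v y) = x \<bullet> (A11 *\<^sub>v y) - x \<bullet> ((A12 * G * transpose_mat A12) *\<^sub>v y)"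
      unfolding M_def using carr x y
      by (simp only: minus_mult_distrib_mat_vec[of _ n n] scalar_prod_minus_distrib[of _ n] mult_mat_vec_carrier)
    also have "(A12 * G * transpose_mat A12) *\<^sub>v y = A12 *\<^sub>v u"
      unfolding u_def Z(3)[OF y] using carr Gc y
      by (simp add: assoc_mult_mat_vec[of _ n n _ n] mult_carrier_mat[of _ n n])
    also have "x \<bullet> (A12 *\<^sub>v u) = (A22 *\<^sub>v Z x) \<bullet> u"
      unfolding Z(3)[OF x] using transpose_vec_mult_scalar[OF carr(2) u x] by simp
    also have "\<dots> = Z x \<bullet> (A22 *\<^sub>v u)"
      using symmetric_mat_scalar_prod[OF carr(3) sym(2) Z(1)[OF x] u] by simp
    also have "A22 *\<^sub>v u = (A22 * G * A22) *\<^sub>v Z y"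
      unfolding u_def using carr Gc Z(1)[OF y]
      by (simp add: assoc_mult_mat_vec[of _ n n _ n] mult_carrier_mat[of _ n n])
    finally show ?thesis unfolding GG .
  qed
  show "transpose_mat M = M"
  proof (rule symmetric_matI[OF M])
    fix x y :: "real vec" assume x: "x \<in> carrier_vec n" and y: "y \<in> carrier_vec n"
    have "u \<bullet> (A *\<^sub>v v) = v \<bullet> (A *\<^sub>v u)"
      if "A \<in> carrier_mat n n" "transpose_mat A = A" "u \<in> carrier_vec n" "v \<in> carrier_vec n" for A :: "real mat" and u v
      using symmetric_mat_scalar_prod[OF that] that by (metis comm_scalar_prod mult_mat_vec_carrier)
    then show "x \<bullet> (M *\<^sub>v y) = y \<bullet> (M *\<^sub>v x)"
      unfolding form[OF x y] form[OF y x] using carr sym x y Z(1) by metis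
  qed
  assume x: "x \<in> carrier_vec n"
  have "Z x \<bullet> (A22 *\<^sub>v Z x) = x \<bullet> (A12 *\<^sub>v Z x)"
    unfolding Z(3)[OF x]
    using transpose_vec_mult_scalar[OF carr(2) Z(1)[OF x] x] x carr Z(1)[OF x]
    by (metis comm_scalar_prod mult_mat_vec_carrier transpose_carrier_mat)
  then show "\<exists>z\<in>carrier_vec n. (\<Sum>a<n. z $ a) = 0 \<and>
      z \<bullet> (A22 *\<^sub>v z) = x \<bullet> (A12 *\<^sub>v z) \<and> x \<bullet> (M *\<^sub>v x) = x \<bullet> (A11 *\<^sub>v x) - z \<bullet> (A22 *\<^sub>v z)"
    using form[OF x x] Z x by blast
qed

text \<open>The subtracted term is at once a value of the A22 form at z and a mixed value of A12 at
  x and z. Its lower bound in |z| and its upper bound in |x| |z| together eliminate z.\<close>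

lemma schur_complement_form_ge:
  fixes A11 A12 A22 G :: "real mat"
  defines "M \<equiv> A11 - A12 * G * transpose_mat A12"
  assumes carr: "A11 \<in> carrier_mat n n" "A12 \<in> carrier_mat n n" "A22 \<in> carrier_mat n n"
    and sym: "transpose_mat A11 = A11" "transpose_mat A22 = A22"
    and ker: "A12 *\<^sub>v ones_vec n = 0\<^sub>v n" "A22 *\<^sub>v ones_vec n = 0\<^sub>v n"
    and c: "c > 0"
    and A22_ge: "\<And>y. y \<in> carrier_vec n \<Longrightarrow> (\<Sum>a<n. y $ a) = 0 \<Longrightarrow> y \<bullet> (A22 *\<^sub>v y) \<ge> c * (y \<bullet> y)"
    and A11_ge: "\<And>x. x \<in> carrier_vec n \<Longrightarrow> (\<Sum>a<n. x $ a) = 0 \<Longrightarrow> x \<bullet> (A11 *\<^sub>v x) \<ge> \<alpha> * (x \<bullet> x)"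
    and A12_le: "\<And>x y. x \<in> carrier_vec n \<Longrightarrow> y \<in> carrier_vec n \<Longrightarrow>
      (\<Sum>a<n. x $ a) = 0 \<Longrightarrow> (\<Sum>a<n. y $ a) = 0 \<Longrightarrow>
      x \<bullet> (A12 *\<^sub>v y) \<le> b * (sqrt (x \<bullet> x) * sqrt (y \<bullet> y))"
    and G: "gen_inverse A22 G"
    and x: "x \<in> carrier_vec n" "(\<Sum>a<n. x $ a) = 0"
  shows "x \<bullet> (M *\<^sub>v x) \<ge> (\<alpha> - b\<^sup>2 / c) * (x \<bullet> x)"
proof -
  obtain z where z: "z \<in> carrier_vec n" "(\<Sum>a<n. z $ a) = 0"
    and zz: "z \<bullet> (A22 *\<^sub>v z) = x \<bullet> (A12 *\<^sub>v z)"
    and M: "x \<bullet> (M *\<^sub>v x) = x \<bullet> (A11 *\<^sub>v x) - z \<bullet> (A22 *\<^sub>v z)"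
    using schur_complement_form(2)[OF carr sym ker c A22_ge G x(1)] unfolding M_def by blast
  define X Y where "X = sqrt (x \<bullet> x)" and "Y = sqrt (z \<bullet> z)"
  have nonneg: "v \<bullet> v \<ge> 0" if "v \<in> carrier_vec n" for v :: "real vec"
    by (simp add: scalar_prod_def sum_nonneg)
  have X2: "x \<bullet> x = X\<^sup>2" and Y2: "z \<bullet> z = Y\<^sup>2"
    using nonneg x z by (simp_all add: X_def Y_def)
  have "c * Y\<^sup>2 \<le> z \<bullet> (A22 *\<^sub>v z)" "z \<bullet> (A22 *\<^sub>v z) \<le> b * (X * Y)"
    using A22_ge[OF z] A12_le[OF x(1) z(1) x(2) z(2)]
    unfolding zz X_def[symmetric] Y_def[symmetric] by (simp_all add: Y2)
  \<comment> \<open>Any q with c Y^2 <= q <= b X Y satisfies q <= (b X)^2 / c, by completing the square.\<close>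
  moreover have "2 * b * X * Y - c * Y\<^sup>2 \<le> b\<^sup>2 / c * X\<^sup>2"
  proof -
    have "0 \<le> c * (b / c * X - Y)\<^sup>2" using c by simp
    also have "\<dots> = b\<^sup>2 / c * X\<^sup>2 - 2 * b * X * Y + c * Y\<^sup>2"
      using c by (simp add: power2_eq_square algebra_simps)
    finally show ?thesis by simp
  qed
  ultimately have "z \<bullet> (A22 *\<^sub>v z) \<le> b\<^sup>2 / c * X\<^sup>2"
    by (simp add: mult_ac)
  then show ?thesis
    using A11_ge[OF x] unfolding M X2 by (simp add: algebra_simps)
qed

text \<open>The root \<theta> 0 = 0 accounts for the all-ones vector. After
  \<open>zero_sums_deflation\<close> each remaining root has a sum-zero eigenvector, to which the
  form bound applies as a Rayleigh quotient.\<close>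

lemma char_poly_roots_ge:
  fixes M :: "real mat"
  assumes M: "M \<in> carrier_mat n n" and n: "n > 0" and g: "g > 0"
    and sym: "transpose_mat M = M" and ker: "M *\<^sub>v ones_vec n = 0\<^sub>v n"
    and form: "\<And>x. x \<in> carrier_vec n \<Longrightarrow> (\<Sum>a<n. x $ a) = 0 \<Longrightarrow> x \<bullet> (M *\<^sub>v x) \<ge> g * \<beta> * (x \<bullet> x)"
  shows "eigenvector M (ones_vec n) 0 \<and> (\<exists>\<theta>. scaled_eigenvalues M g \<theta>) \<and>
    (\<forall>\<theta>. scaled_eigenvalues M g \<theta> \<longrightarrow> (\<forall>r\<in>{1..n - 1}. \<theta> r \<ge> \<beta>))"
proof -
  obtain k where k: "n = Suc k" using n gr0_implies_Suc by auto
  have rows: "(\<Sum>j<n. M $$ (i,j)) = 0" if "i < n" for i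
  proof -
    have "(M *\<^sub>v ones_vec n) $ i = (\<Sum>j<n. M $$ (i,j))"
      using that M by (simp add: ones_vec_def scalar_prod_def lessThan_atLeast0)
    then show ?thesis using ker that by simp
  qed
  have cols: "(\<Sum>i<n. M $$ (i,j)) = 0" if "j < n" for j
  proof -
    have "M $$ (i,j) = M $$ (j,i)" if "i < n" for i
      using sym that \<open>j < n\<close> M by (metis index_transpose_mat(1) carrier_matD)
    then have "(\<Sum>i<n. M $$ (i,j)) = (\<Sum>i<n. M $$ (j,i))" by simp
    then show ?thesis using rows[OF that] by simp
  qed
  obtain C' where C': "C' \<in> carrier_mat k k" and char: "char_poly M = [:0, 1:] * char_poly C'"
    and ev: "\<And>l. eigenvalue C' l \<Longrightarrow>
       \<exists>x\<in>carrier_vec n. x \<noteq> 0\<^sub>v n \<and> (\<Sum>a<n. x $ a) = 0 \<and> M *\<^sub>v x = l \<cdot>\<^sub>v x"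
    using zero_sums_deflation[of M k] M rows cols unfolding k by metis
  have "ones_vec n \<noteq> 0\<^sub>v n"
    unfolding k by (auto simp: ones_vec_def dest!: arg_cong[of _ _ "\<lambda>v. v $ 0"])
  then have 1: "eigenvector M (ones_vec n) 0"
    using M ker by (auto simp: eigenvector_def)
  have 2: "\<exists>\<theta>. scaled_eigenvalues M g \<theta>"
  proof -
    obtain as where as: "char_poly M = (\<Prod>a\<leftarrow>as. [:- a, 1:])" and len: "length as = n"
      using real_symmetric_char_poly_splits[OF M sym] by blast
    have "poly (char_poly M) 0 = 0" by (simp add: char)
    then have "0 \<in> set as"
      unfolding as poly_prod_list by (auto simp: prod_list_zero_iff)
    \<comment> \<open>The enumeration must start with \<theta> 0 = 0, so one zero root is moved to
      the front.\<close>
    define bs where "bs = 0 # remove1 0 as"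
    have bs: "char_poly M = (\<Prod>a\<leftarrow>bs. [:- a, 1:])" "length bs = n"
      unfolding as bs_def using len n prod_list_map_remove1[OF \<open>0 \<in> set as\<close>, of "\<lambda>a. [:- a, 1:]"] \<open>0 \<in> set as\<close>
      by (simp_all add: length_remove1)
    define \<theta> where "\<theta> r = bs ! r / g" for r
    have "(\<Prod>a\<leftarrow>bs. [:- a, 1:]) = (\<Prod>r<n. [:- (real g * \<theta> r), 1:])"
      using g bs(2) by (auto simp: \<theta>_def lessThan_atLeast0 prod.list_conv_set_nth intro!: prod.cong)
    then have "scaled_eigenvalues M g \<theta>"
      using M bs unfolding scaled_eigenvalues_def by (auto simp: \<theta>_def bs_def)
    then show ?thesis by blast
  qed
  have 3: "\<theta> r \<ge> \<beta>" if \<theta>: "scaled_eigenvalues M g \<theta>" and r: "r \<in> {1..n - 1}" for \<theta> r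
  proof -
    \<comment> \<open>The factor for index 0 is X itself; cancelling it leaves exactly the roots
      with positive index for \<open>C'\<close>.\<close>
    have "[:0, 1:] * char_poly C' = [:0, 1:] * (\<Prod>r<k. [:- (real g * \<theta> (Suc r)), 1:])"
      using \<theta> M unfolding char[symmetric] scaled_eigenvalues_def k
      by (simp add: prod.lessThan_Suc_shift del: prod.lessThan_Suc)
    then have "char_poly C' = (\<Prod>r<k. [:- (real g * \<theta> (Suc r)), 1:])"
      by (metis mult_left_cancel pCons_eq_0_iff zero_neq_one)
    moreover obtain q where q: "r = Suc q" "q < k"
      using r k by (cases r) auto
    ultimately have "poly (char_poly C') (g * \<theta> r) = 0"
      by (auto simp: poly_prod prod_zero_iff)
    then have "eigenvalue C' (g * \<theta> r)"
      using eigenvalue_root_char_poly[OF C'] by blast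
    then obtain x where x: "x \<in> carrier_vec n" "x \<noteq> 0\<^sub>v n" "(\<Sum>a<n. x $ a) = 0"
      and Mx: "M *\<^sub>v x = (g * \<theta> r) \<cdot>\<^sub>v x"
      using ev by blast
    have "x \<bullet> x > 0"
      using x conjugate_square_greater_0_vec[of x n] by simp
    moreover have "g * \<beta> * (x \<bullet> x) \<le> g * \<theta> r * (x \<bullet> x)"
      using form[OF x(1,3)] x(1) by (simp add: Mx)
    ultimately show ?thesis using g by simp
  qed
  show ?thesis using 1 2 3 by blast
qed

section \<open>The bound on the eigenvalues\<close>

text \<open>All fibres have one size e, and taking h = 1 identifies e with \<open>c\<close>.\<close>

lemma sum_equal_fibres:
  fixes h :: "'b \<Rightarrow> real"
  assumes "finite S" "finite R" "R \<noteq> {}" and f: "f ` S \<subseteq> R"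
    and fib: "\<And>a b. a \<in> R \<Longrightarrow> b \<in> R \<Longrightarrow> card {x \<in> S. f x = a} = card {x \<in> S. f x = b}"
    and card: "card S = c * card R"
  shows "(\<Sum>x\<in>S. h (f x)) = c * (\<Sum>a\<in>R. h a)"
proof -
  obtain r where r: "r \<in> R" using \<open>R \<noteq> {}\<close> by blast
  define e where "e = card {x \<in> S. f x = r}"
  have sum: "(\<Sum>x\<in>S. h (f x)) = e * (\<Sum>a\<in>R. h a)" for h :: "'b \<Rightarrow> real"
    unfolding sum_fun_comp[OF assms(1,2) f, of h] sum_distrib_left e_def
    by (intro sum.cong refl) (simp add: fib[OF _ r])
  from sum[of "\<lambda>_. 1"] have "real (c * card R) = real (e * card R)"
    by (simp add: card)
  then have "c = e"
    using assms(2,3) by (simp only: of_nat_eq_iff) simp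
  then show ?thesis using sum by simp
qed

text \<open>Uniformity only asserts equal counts; their values come from counting. The t periods of
  a subject give 1 per treatment, the g t subjects of a period give g, and counting all successions
  fixes the balance constant.\<close>

lemma UBRMD_balanced_plan:
  assumes U: "UBRMD t g d" and t: "t = p + m" and p: "p > 0" and t2: "t \<ge> 2"
  shows "balanced_plan t m g p (\<lambda>k i. d $$ (k,i))"
proof
  have dim: "dim_row d = t" "dim_col d = g * t" and range: "\<And>k i. k < t \<Longrightarrow> i < g * t \<Longrightarrow> d $$ (k,i) < t"
    and g: "g > 0" and unif: "uniform t d" and bal: "balanced t d"
    using U by (auto simp: UBRMD_def is_design_def)
  show "t = p + m" "p > 0" by fact+
  have subject: "card {k \<in> {..<t}. d $$ (k,i) = a} = card {k \<in> {..<t}. d $$ (k,i) = b}"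
    if "i < g * t" "a < t" "b < t" for i a b
    using unif that unfolding uniform_def dim lessThan_iff by blast
  have period: "card {i \<in> {..<g * t}. d $$ (k,i) = a} = card {i \<in> {..<g * t}. d $$ (k,i) = b}"
    if "k < t" "a < t" "b < t" for k a b
    using unif that unfolding uniform_def dim lessThan_iff by blast
  show "(\<Sum>k<t. h (d $$ (k,i))) = (\<Sum>a<t. h a)" if i: "i < g * t" for h :: "nat \<Rightarrow> real" and i
  proof -
    have "(\<Sum>k<t. h (d $$ (k,i))) = real 1 * (\<Sum>a<t. h a)"
    proof (rule sum_equal_fibres)
      show "{..<t} \<noteq> {}" using t2 by (simp add: lessThan_empty_iff)
      show "(\<lambda>k. d $$ (k,i)) ` {..<t} \<subseteq> {..<t}" using range i by auto
      show "card {k \<in> {..<t}. d $$ (k,i) = a} = card {k \<in> {..<t}. d $$ (k,i) = b}"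
        if "a \<in> {..<t}" "b \<in> {..<t}" for a b
        using subject[OF i] that by blast
    qed simp_all
    then show ?thesis by simp
  qed
  show "(\<Sum>i<g * t. h (d $$ (k,i))) = g * (\<Sum>a<t. h a)" if k: "k < t" for h :: "nat \<Rightarrow> real" and k
  proof (rule sum_equal_fibres)
    show "{..<t} \<noteq> {}" using t2 by (simp add: lessThan_empty_iff)
    show "(\<lambda>i. d $$ (k,i)) ` {..<g * t} \<subseteq> {..<t}" using range[OF k] by auto
    show "card {i \<in> {..<g * t}. d $$ (k,i) = a} = card {i \<in> {..<g * t}. d $$ (k,i) = b}"
      if "a \<in> {..<t}" "b \<in> {..<t}" for a b
      using period[OF k] that by blast
  qed simp_all
  define S where "S = {..<t - 1} \<times> {..<g * t}"
  define f where "f = (\<lambda>(k,i). (d $$ (k,i), d $$ (Suc k,i)))"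
  obtain l where l: "\<And>a b. a < t \<Longrightarrow> b < t \<Longrightarrow> precede_count d a b = (if a = b then 0 else l)"
    using bal by (auto simp: balanced_def)
  have f: "f ` S \<subseteq> {..<t} \<times> {..<t}"
    using range by (force simp: f_def S_def)
  have fib: "card {x \<in> S. f x = (a,b)} = precede_count d a b" for a b
    unfolding precede_count_def by (rule arg_cong[of _ _ card]) (auto simp: S_def f_def dim)
  have sum: "(\<Sum>k<t - 1. \<Sum>i<g * t. h (d $$ (k,i)) (d $$ (Suc k,i))) =
      l * ((\<Sum>a<t. \<Sum>b<t. h a b) - (\<Sum>a<t. h a a))" for h :: "nat \<Rightarrow> nat \<Rightarrow> real"
  proof -
    have "(\<Sum>k<t - 1. \<Sum>i<g * t. h (d $$ (k,i)) (d $$ (Suc k,i))) = (\<Sum>x\<in>S. case_prod h (f x))"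
      unfolding S_def by (simp add: sum.cartesian_product f_def split_def)
    also have "\<dots> = (\<Sum>y\<in>{..<t} \<times> {..<t}. of_nat (card {x \<in> S. f x = y}) * case_prod h y)"
      by (rule sum_fun_comp) (use f in \<open>auto simp: S_def\<close>)
    also have "\<dots> = (\<Sum>a<t. \<Sum>b<t. l * h a b - (if b = a then l * h a a else 0))"
      by (subst sum.cartesian_product, intro sum.cong refl) (auto simp: fib l)
    also have "\<dots> = l * ((\<Sum>a<t. \<Sum>b<t. h a b) - (\<Sum>a<t. h a a))"
      by (simp add: sum_subtractf sum_distrib_left right_diff_distrib)
    finally show ?thesis .
  qed
  \<comment> \<open>With h = 1 both sides count all successions: (t - 1) g t = l t (t - 1).\<close>
  have "real (t - 1) * (real g * t) = l * (real t * t - t)"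
    using sum[of "\<lambda>_ _. 1"] by simp
  then have "(real t * (real t - 1)) * g = (real t * (real t - 1)) * l"
    using t2 by (simp add: of_nat_diff algebra_simps)
  then have "g = l" using t2 by simp
  then show "(\<Sum>k<t - 1. \<Sum>i<g * t. x (d $$ (Suc k,i)) * y (d $$ (k,i))) =
      g * ((\<Sum>a<t. x a) * (\<Sum>a<t. y a) - (\<Sum>a<t. x a * y a))" for x y :: "nat \<Rightarrow> real"
    using sum[of "\<lambda>a b. x b * y a"] sum_product[of y "{..<t}" x "{..<t}"] by (simp add: mult.commute)
qed

text \<open>On the all-ones treatment vector the direct values are constantly 1, and the carry-over
  values are 0 in the first period and 1 afterwards. Both are pure period effects, which the
  adjusted inner product annihilates.\<close>

lemma
  assumes d: "is_design p s t d" and "p > 0" "s > 0"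
  shows C11_ones: "C11 t d *\<^sub>v ones_vec t = 0\<^sub>v t"
    and C12_ones: "C12 t d *\<^sub>v ones_vec t = 0\<^sub>v t"
    and C21_ones: "C21 t d *\<^sub>v ones_vec t = 0\<^sub>v t"
    and C22_ones: "C22 t d *\<^sub>v ones_vec t = 0\<^sub>v t"
proof -
  have range: "d $$ (k,i) < t" if "k < p" "i < s" for k i
    using d that by (auto simp: is_design_def)
  have dir: "adjusted_form p s f (direct d (ones_vec t)) = 0" for f
    using adjusted_form_period_effect[OF assms(2,3), of f "\<lambda>_. 1"] range
    by (subst adjusted_form_cong[of p s f f _ "\<lambda>_ _. 1"]) (auto simp: direct_def ones_vec_def)
  have car: "adjusted_form p s f (carry_over d (ones_vec t)) = 0" for f
    using adjusted_form_period_effect[OF assms(2,3), of f "\<lambda>k. if k = 0 then 0 else 1"] range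
    by (subst adjusted_form_cong[of p s f f _ "\<lambda>k _. if k = 0 then 0 else 1"])
      (auto simp: carry_over_def ones_vec_def)
  show "C11 t d *\<^sub>v ones_vec t = 0\<^sub>v t" "C12 t d *\<^sub>v ones_vec t = 0\<^sub>v t" "C22 t d *\<^sub>v ones_vec t = 0\<^sub>v t"
    by (rule vec_zeroI, rule mult_mat_vec_carrier, rule C_carrier, rule ones_vec_carrier,
        simp add: C11_form[OF d] C12_form[OF d] C22_form[OF d] dir car)+
  show "C21 t d *\<^sub>v ones_vec t = 0\<^sub>v t"
  proof (rule vec_zeroI)
    show "C21 t d *\<^sub>v ones_vec t \<in> carrier_vec t"
      unfolding C21_def by (intro mult_mat_vec_carrier[of _ t t]) auto
    fix x :: "real vec" assume x: "x \<in> carrier_vec t"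
    have "x \<bullet> (C21 t d *\<^sub>v ones_vec t) = (C21 t d *\<^sub>v ones_vec t) \<bullet> x"
      using x \<open>C21 t d *\<^sub>v ones_vec t \<in> carrier_vec t\<close> by (rule comm_scalar_prod)
    also have "\<dots> = ones_vec t \<bullet> (C12 t d *\<^sub>v x)"
      unfolding C21_def by (rule transpose_vec_mult_scalar[OF C_carrier(2) x ones_vec_carrier])
    also have "\<dots> = 0"
      using dir adjusted_form_commute by (simp add: C12_form[OF d] x)
    finally show "x \<bullet> (C21 t d *\<^sub>v ones_vec t) = 0" .
  qed
qed

lemma
  assumes d: "is_design p s t d"
  shows C11_symmetric: "transpose_mat (C11 t d) = C11 t d"
    and C22_symmetric: "transpose_mat (C22 t d) = C22 t d"
  by (rule symmetric_matI, rule C_carrier,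
      simp add: C11_form[OF d] C22_form[OF d] adjusted_form_commute)+

text \<open>The existence clause keeps the bound, stated for every enumeration, from being vacuous.
  \<open>G\<close> is an arbitrary generalized inverse.\<close>

theorem theorem5:
  fixes t m g :: nat
    and d_plan d_min :: design
    and G C :: "real mat"
  assumes "m \<ge> 1"
    and "t \<ge> 2 * m + 2"
    and "UBRMD t g d_plan"
    and "d_min = first_periods (t - m) d_plan"
    and "gen_inverse (C22 t d_min) G"
    and "C = C_D t d_min G"
  shows "eigenvector C (ones_vec t) 0 \<and>
    (\<exists>\<theta>. scaled_eigenvalues C g \<theta>) \<and>
    (\<forall>\<theta>. scaled_eigenvalues C g \<theta> \<longrightarrow> (\<forall>r\<in>{1..t - 1}. \<theta> r \<ge> theta_L t m))"
proof -
  define p where "p = t - m"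
  define s where "s = g * t"
  have t: "t = p + m" and p: "p > 0" and pm: "p \<ge> m + 2"
    using assms(2) by (auto simp: p_def)
  have g: "g > 0" and dim: "dim_row d_plan = t" "dim_col d_plan = s"
    and range: "\<And>k i. k < t \<Longrightarrow> i < s \<Longrightarrow> d_plan $$ (k,i) < t"
    using assms(3) by (auto simp: UBRMD_def is_design_def s_def)
  have s: "s > 0" using g t p by (simp add: s_def)
  have entry: "d_min $$ (k,i) = d_plan $$ (k,i)" if "k < p" "i < s" for k i
    using that by (simp add: assms(4) first_periods_def p_def dim)
  have "d_min \<in> carrier_mat p s"
    by (simp add: assms(4) first_periods_def p_def dim)
  moreover have "d_min $$ (k,i) < t" if "k < p" "i < s" for k i
    using entry[OF that] range[of k i] that by (simp add: t)
  ultimately have d: "is_design p s t d_min"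
    by (simp add: is_design_def)
  interpret balanced_plan t m g p "\<lambda>k i. d_plan $$ (k,i)"
    using UBRMD_balanced_plan[OF assms(3) t p] assms(2) by simp
  have direct: "adjusted_form p s (direct d_min x) (direct d_min y) =
      adjusted_form p (g * t) (\<lambda>k i. x $ (d_plan $$ (k,i))) (\<lambda>k i. y $ (d_plan $$ (k,i)))"
    and mixed: "adjusted_form p s (direct d_min x) (carry_over d_min y) =
      adjusted_form p (g * t) (\<lambda>k i. x $ (d_plan $$ (k,i))) (carry (\<lambda>a. y $ a))"
    and carry: "adjusted_form p s (carry_over d_min x) (carry_over d_min y) =
      adjusted_form p (g * t) (carry (\<lambda>a. x $ a)) (carry (\<lambda>a. y $ a))" for x y
    unfolding s_def[symmetric]
    by (rule adjusted_form_cong; simp add: direct_def carry_over_def entry)+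
  have sq: "x \<bullet> x = sq (\<lambda>a. x $ a)" if "x \<in> carrier_vec t" for x :: "real vec"
    using that by (simp add: scalar_prod_def power2_eq_square lessThan_atLeast0)
  define \<alpha> where "\<alpha> = g * (p - m\<^sup>2 / p)"
  define c where "c = g * (real p - 1 - (real m + 1)\<^sup>2 / p)"
  define b where "b = g * ((real m + 1) * t / p)"
  \<comment> \<open>This is the denominator in \<open>theta_L\<close>. It is positive because t >=
    2m + 2 gives p >= m + 2, hence p (p - 1) >= (m + 2)(m + 1) > (m + 1)^2.\<close>
  have den: "real p * (real p - 1) - (real m + 1)\<^sup>2 > 0"
  proof -
    have "(real m + 2) * (real m + 1) \<le> real p * (real p - 1)"
      using pm by (intro mult_mono) auto
    then show ?thesis by (simp add: power2_eq_square algebra_simps)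
  qed
  have c_eq: "c = g * (real p * (real p - 1) - (real m + 1)\<^sup>2) / p"
    using p by (simp add: c_def field_simps)
  then have c: "c > 0" using den g p by simp
  have C: "C = C11 t d_min - C12 t d_min * G * transpose_mat (C12 t d_min)"
    by (simp add: assms(6) C_D_def C21_def)
  have C22_ge: "y \<bullet> (C22 t d_min *\<^sub>v y) \<ge> c * (y \<bullet> y)"
    if "y \<in> carrier_vec t" "(\<Sum>a<t. y $ a) = 0" for y
    unfolding C22_form[OF d that(1) that(1)] carry c_def sq[OF that(1)] by (rule carry_form_ge[OF that(2)])
  have C11_ge: "x \<bullet> (C11 t d_min *\<^sub>v x) \<ge> \<alpha> * (x \<bullet> x)"
    if "x \<in> carrier_vec t" "(\<Sum>a<t. x $ a) = 0" for x
    unfolding C11_form[OF d that(1) that(1)] direct \<alpha>_def sq[OF that(1)] by (rule direct_form_ge[OF that(2)])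
  have C12_le: "x \<bullet> (C12 t d_min *\<^sub>v y) \<le> b * (sqrt (x \<bullet> x) * sqrt (y \<bullet> y))"
    if "x \<in> carrier_vec t" "y \<in> carrier_vec t" "(\<Sum>a<t. x $ a) = 0" "(\<Sum>a<t. y $ a) = 0" for x y
    unfolding C12_form[OF d that(1,2)] mixed b_def sq[OF that(1)] sq[OF that(2)]
    by (rule order_trans[OF abs_ge_self mixed_form_le[OF that(3,4)]])
  have theta: "g * theta_L t m = \<alpha> - b\<^sup>2 / c"
  proof -
    define D where "D = real p * (real p - 1) - (real m + 1)\<^sup>2"
    have tm: "real t - real m = p" "real t = p + m" using t by simp_all
    have "(real t - real m)\<^sup>2 - (real t + 1) - real m * (real m + 1) = D"
      by (simp add: D_def tm power2_eq_square algebra_simps)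
    then have L: "theta_L t m = t / p * ((real t - 2 * m) - t * (real m + 1)\<^sup>2 / D)"
      unfolding theta_L_def Let_def by (simp add: tm(1))
    \<comment> \<open>Uses p^2 - m^2 = (p + m)(p - m) = t (t - 2m).\<close>
    have 1: "\<alpha> = g * (t / p * (real t - 2 * m))"
      using p by (simp add: \<alpha>_def tm(2) field_simps power2_eq_square)
    have 2: "b\<^sup>2 / c = g * (t / p * (t * (real m + 1)\<^sup>2 / D))"
      using p g den unfolding b_def c_eq D_def[symmetric] by (simp add: field_simps power2_eq_square)
    show ?thesis unfolding L 1 2 by (simp add: right_diff_distrib)
  qed
  have ker: "C *\<^sub>v ones_vec t = 0\<^sub>v t"
  proof -
    have G: "G \<in> carrier_mat t t"
      using assms(5) C_carrier(3)[of t d_min] by (auto simp: gen_inverse_def)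
    have "C12 t d_min * G \<in> carrier_mat t t" "transpose_mat (C12 t d_min) \<in> carrier_mat t t"
      using G by (auto intro: mult_carrier_mat[of _ t t])
    then have "C *\<^sub>v ones_vec t = C11 t d_min *\<^sub>v ones_vec t -
        C12 t d_min * G *\<^sub>v (C21 t d_min *\<^sub>v ones_vec t)"
      unfolding C C21_def
      by (simp add: minus_mult_distrib_mat_vec[of _ t t] mult_carrier_mat[of _ t t] assoc_mult_mat_vec[of _ t t _ t])
    also have "\<dots> = 0\<^sub>v t"
      unfolding C11_ones[OF d p s] C21_ones[OF d p s]
      using \<open>C12 t d_min * G \<in> carrier_mat t t\<close> by (intro eq_vecI) (auto simp: scalar_prod_def)
    finally show ?thesis .
  qed
  have carr: "C \<in> carrier_mat t t"
    unfolding C using assms(5) C_carrier(3)[of t d_min]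
    by (intro minus_carrier_mat mult_carrier_mat[of _ t t]) (auto simp: gen_inverse_def)
  have sym: "transpose_mat C = C"
    unfolding C using C_carrier C11_symmetric[OF d] C22_symmetric[OF d] C12_ones[OF d p s] C22_ones[OF d p s] c C22_ge assms(5)
    by (rule schur_complement_form(1))
  have form: "x \<bullet> (C *\<^sub>v x) \<ge> g * theta_L t m * (x \<bullet> x)"
    if "x \<in> carrier_vec t" "(\<Sum>a<t. x $ a) = 0" for x
    unfolding C theta
    using C_carrier C11_symmetric[OF d] C22_symmetric[OF d] C12_ones[OF d p s] C22_ones[OF d p s] c
      C22_ge C11_ge C12_le assms(5) that
    by (rule schur_complement_form_ge)
  have "t > 0" using t p by simp
  then show ?thesis
    using carr g sym ker form by (intro char_poly_roots_ge)
qed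

end
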